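(* A line $y=y'=0$ in $\mathbb P(A_1^* )$ is a commuting line if and only if the corresponding point in $\mathbb G(1,3)$ lies on the smooth conic $C_0\subseteq\mathbb P^5$ given by $$z_{01}z_{23}+z_{02}z_{31}+z_{03}z_{12}\;=\;z_{23}+\alpha z_{01}\;=\;z_{31}+\beta z_{02}\;=\;z_{12}+\gamma z_{03}\;=\;0.$$ There is an isomorphism $\psi:\mathbb P^1\to C_0$ given, in the coordinates $(z_{01},z_{02},z_{03},z_{12},z_{13},z_{23})$, by the formulas $$\psi(s,t)=\big(\mathbf ia^{-1}(s^2+t^2),\,2b^{-1}st,\,c^{-1}(s^2-t^2),\,-c(s^2-t^2),\,2bst,\,-\mathbf ia(s^2+t^2)\big)$$ and $\psi^{-1}(z_{01},\dots,z_{23})=(cz_{03}-\mathbf iaz_{01},\,bz_{02})$.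
   Context: Let $k$ be an algebraically closed field of characteristic $\neq2,3$; let $\alpha_1,\alpha_2,\alpha_3\in k\setminus\{0,1,-1\}$ with $\alpha_1+\alpha_2+\alpha_3+\alpha_1\alpha_2\alpha_3=0$; write $\alpha=\alpha_1,\beta=\alpha_2,\gamma=\alpha_3$; fix $a,b,c,\mathbf i\in k$ with $a^2=\alpha,b^2=\beta,c^2=\gamma,\mathbf i^2=-1$. $A$ is the graded $k$-algebra generated by $y_0,\dots,y_3$ (degree 1) with relations $y_0y_i-y_iy_0=\alpha_i(y_jy_k-y_ky_j)$, $y_0y_i+y_iy_0=y_jy_k+y_ky_j$ for all cyclic permutations $(i,j,k)$ of $(1,2,3)$; $A_1$ is its degree-one component, with basis $y_0,\dots,y_3$. A 2-dimensional subspace $ky+ky'\subseteq A_1$ is commuting if $yy'=y'y$ in $A$; the line $y=y'=0$ in $\mathbb P(A_1^* )$ is then called a commuting line. $\mathbb G(1,3)$ is the Grassmannian of lines in $\mathbb P(A_1^* )\cong\mathbb P^3$; the Plücker coordinates of the line $\sum\lambda_jy_j=\sum\lambda_j'y_j=0$ are $z_{rs}=\lambda_r\lambda_s'-\lambda_r'\lambda_s$, with $z_{sr}=-z_{rs}$, and $\mathbb G(1,3)\subseteq\mathbb P^5$ is the quadric $z_{01}z_{23}+z_{02}z_{31}+z_{03}z_{12}=0$.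
   Formalization: The formula for ψ^{-1} is asserted at every point of C_0 except ψ(0,1), where both of its coordinates vanish and it defines no point of P^1; that ψ^{-1} is a morphism on all of C_0 is still proved. *)

theory Defs
  imports
    "HOL-Algebra.QuotRing"
    "HOL-Analysis.Cartesian_Space"
    "HOL-Library.Poly_Mapping"
    "HOL-Computational_Algebra.Polynomial"
begin

section \<open>Projective spaces and homogeneous polynomials\<close>

text \<open>A point of the projective space of lines in \<open>k\<^sup>n\<close> is a one-dimensional subspace. Note that
  \<open>pt 0 = {0}\<close> is not a point.\<close>

definition pt :: "'k::field ^ 'n \<Rightarrow> ('k ^ 'n) set" where
  "pt v = vec.span {v}"

definition proj_space :: "('k::field ^ 'n) set set" where
  "proj_space = {pt v |v. v \<noteq> 0}"

text \<open>Polynomials in variables indexed by \<open>'n\<close>: finitely supported functions on exponent vectors.\<close>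

type_synonym ('n, 'k) mpoly = "('n \<Rightarrow>\<^sub>0 nat) \<Rightarrow>\<^sub>0 'k"

definition mpoly_var :: "'n \<Rightarrow> ('n, 'k::field) mpoly" where
  "mpoly_var i = Poly_Mapping.single (Poly_Mapping.single i 1) 1"

definition mpoly_const :: "'k::field \<Rightarrow> ('n, 'k) mpoly" where
  "mpoly_const c = Poly_Mapping.single 0 c"

definition mpoly_eval :: "('n::finite, 'k::field) mpoly \<Rightarrow> 'k ^ 'n \<Rightarrow> 'k" where
  "mpoly_eval f v = (\<Sum>m\<in>Poly_Mapping.keys f.
     Poly_Mapping.lookup f m * (\<Prod>i\<in>UNIV. (v $ i) ^ Poly_Mapping.lookup m i))"

definition homogeneous :: "nat \<Rightarrow> ('n::finite, 'k::field) mpoly \<Rightarrow> bool" where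
  "homogeneous d f \<longleftrightarrow>
     (\<forall>m\<in>Poly_Mapping.keys f. (\<Sum>i\<in>UNIV. Poly_Mapping.lookup m i) = d)"

text \<open>The formal partial derivative. In a term with \<open>m\<^sub>i = 0\<close> the exponent subtraction truncates,
  but the coefficient vanishes.\<close>

definition mpoly_partial :: "'n \<Rightarrow> ('n, 'k::field) mpoly \<Rightarrow> ('n, 'k) mpoly" where
  "mpoly_partial i f = (\<Sum>m\<in>Poly_Mapping.keys f.
     Poly_Mapping.single (m - Poly_Mapping.single i 1)
       (of_nat (Poly_Mapping.lookup m i) * Poly_Mapping.lookup f m))"

definition mpoly_gradient :: "('n::finite, 'k::field) mpoly \<Rightarrow> 'k ^ 'n \<Rightarrow> 'k ^ 'n" where
  "mpoly_gradient f v = (\<chi> i. mpoly_eval (mpoly_partial i f) v)"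

definition proj_zeros :: "('n::finite, 'k::field) mpoly set \<Rightarrow> ('k ^ 'n) set set" where
  "proj_zeros S = {pt v |v. v \<noteq> 0 \<and> (\<forall>f\<in>S. mpoly_eval f v = 0)}"

definition zariski_open :: "('k::field ^ 'n::finite) set set \<Rightarrow> bool" where
  "zariski_open U \<longleftrightarrow>
     (\<exists>S :: ('n, 'k) mpoly set. (\<forall>f\<in>S. \<exists>d. homogeneous d f) \<and> U = proj_space - proj_zeros S)"

text \<open>A morphism between (locally closed) subsets of projective spaces over an algebraically
  closed field is a map which is, locally in the Zariski topology, given by homogeneous polynomials
  of one common degree without common zero.\<close>

definition is_morphism ::
  "('k::field ^ 'm::finite) set set \<Rightarrow> ('k ^ 'n::finite) set set \<Rightarrow>
   (('k ^ 'm) set \<Rightarrow> ('k ^ 'n) set) \<Rightarrow> bool" where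
  "is_morphism X Y f \<longleftrightarrow>
     (\<forall>P\<in>X. f P \<in> Y) \<and>
     (\<forall>P\<in>X. \<exists>U. zariski_open U \<and> P \<in> U \<and>
        (\<exists>d. \<exists>F :: 'n \<Rightarrow> ('m, 'k) mpoly. (\<forall>j. homogeneous d (F j)) \<and>
           (\<forall>v. pt v \<in> X \<inter> U \<longrightarrow>
              (\<chi> j. mpoly_eval (F j) v) \<noteq> 0 \<and> f (pt v) = pt (\<chi> j. mpoly_eval (F j) v))))"

definition is_isomorphism ::
  "('k::field ^ 'm::finite) set set \<Rightarrow> ('k ^ 'n::finite) set set \<Rightarrow>
   (('k ^ 'm) set \<Rightarrow> ('k ^ 'n) set) \<Rightarrow> bool" where
  "is_isomorphism X Y f \<longleftrightarrow>
     bij_betw f X Y \<and> is_morphism X Y f \<and> is_morphism Y X (inv_into X f)"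

text \<open>The equations \<open>q = 0\<close> and \<open>l = 0\<close> (\<open>l \<in> L\<close>) define a smooth conic in the projective space with
  coordinates indexed by \<open>'n\<close>: the linear forms \<open>L\<close> cut out a plane, \<open>q\<close> is quadratic, and the
  Jacobian criterion holds everywhere. The projective space has dimension \<open>CARD('n) - 1\<close>, so a
  curve in it has codimension \<open>CARD('n) - 2\<close>.\<close>

definition defines_smooth_conic ::
  "('n::finite, 'k::field) mpoly \<Rightarrow> ('n, 'k) mpoly set \<Rightarrow> bool" where
  "defines_smooth_conic q L \<longleftrightarrow>
     homogeneous 2 q \<and> (\<forall>l\<in>L. homogeneous 1 l) \<and>
     vec.dim {v. \<forall>l\<in>L. mpoly_eval l v = 0} = 3 \<and>
     (\<forall>v. v \<noteq> 0 \<and> (\<forall>f\<in>insert q L. mpoly_eval f v = 0) \<longrightarrow>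
        vec.dim ((\<lambda>f. mpoly_gradient f v) ` insert q L) = CARD('n) - 2)"


section \<open>The algebra and its commuting lines\<close>

text \<open>Words under concatenation (written additively) are the free monoid, so that finitely
  supported functions on words, with convolution, are the free associative algebra.\<close>

datatype 'a wrd = Wrd "'a list"

primrec letters :: "'a wrd \<Rightarrow> 'a list" where
  "letters (Wrd xs) = xs"

instantiation wrd :: (type) monoid_add
begin

definition zero_wrd :: "'a wrd" where
  "0 = Wrd []"

definition plus_wrd :: "'a wrd \<Rightarrow> 'a wrd \<Rightarrow> 'a wrd" where
  "u + v = Wrd (letters u @ letters v)"

instance
proof
  fix u v w :: "'a wrd"
  show "u + v + w = u + (v + w)" by (simp add: plus_wrd_def)
  show "0 + u = u" by (cases u) (simp add: plus_wrd_def zero_wrd_def)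
  show "u + 0 = u" by (cases u) (simp add: plus_wrd_def zero_wrd_def)
qed

end

datatype yidx = I0 | I1 | I2 | I3

instance yidx :: finite
proof
  have "(UNIV :: yidx set) \<subseteq> {I0, I1, I2, I3}"
    by (auto intro: yidx.exhaust)
  then show "finite (UNIV :: yidx set)"
    by (rule finite_subset) simp
qed

type_synonym 'k free_alg = "yidx wrd \<Rightarrow>\<^sub>0 'k"

definition yvar :: "yidx \<Rightarrow> 'k::field free_alg" where
  "yvar j = Poly_Mapping.single (Wrd [j]) 1"

definition scalar :: "'k::field \<Rightarrow> 'k free_alg" where
  "scalar c = Poly_Mapping.single 0 c"

definition free_ring :: "'k::field free_alg ring" where
  "free_ring = \<lparr>carrier = UNIV, monoid.mult = (*), one = 1, zero = 0, add = (+)\<rparr>"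

definition relations :: "'k::field \<Rightarrow> 'k \<Rightarrow> 'k \<Rightarrow> 'k free_alg set" where
  "relations \<alpha> \<beta> \<gamma> =
     (\<Union>(e, i, j, k) \<in> {(\<alpha>, I1, I2, I3), (\<beta>, I2, I3, I1), (\<gamma>, I3, I1, I2)}.
        {(yvar I0 * yvar i - yvar i * yvar I0)
           - scalar e * (yvar j * yvar k - yvar k * yvar j),
         (yvar I0 * yvar i + yvar i * yvar I0)
           - (yvar j * yvar k + yvar k * yvar j)})"

definition rel_ideal :: "'k::field \<Rightarrow> 'k \<Rightarrow> 'k \<Rightarrow> 'k free_alg set" where
  "rel_ideal \<alpha> \<beta> \<gamma> = Idl\<^bsub>free_ring\<^esub> (relations \<alpha> \<beta> \<gamma>)"

definition alg_A :: "'k::field \<Rightarrow> 'k \<Rightarrow> 'k \<Rightarrow> 'k free_alg set ring" where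
  "alg_A \<alpha> \<beta> \<gamma> = free_ring Quot (rel_ideal \<alpha> \<beta> \<gamma>)"

text \<open>The element \<open>\<Sum>\<^sub>j \<lambda>\<^sub>j y\<^sub>j\<close> of the degree-one component \<open>A\<^sub>1\<close>. All relations are quadratic, so the
  \<open>y\<^sub>j\<close> are a basis of \<open>A\<^sub>1\<close>; below \<open>A\<^sub>1\<close> is identified with its coordinate space \<open>k\<^sup>4\<close>.\<close>

definition lin_elem :: "'k::field \<Rightarrow> 'k \<Rightarrow> 'k \<Rightarrow> 'k ^ yidx \<Rightarrow> 'k free_alg set" where
  "lin_elem \<alpha> \<beta> \<gamma> l =
     rel_ideal \<alpha> \<beta> \<gamma> +>\<^bsub>free_ring\<^esub> (\<Sum>j\<in>UNIV. scalar (l $ j) * yvar j)"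

text \<open>The line \<open>y = y' = 0\<close> in the projective space of \<open>A\<^sub>1\<^sup>*\<close>, where \<open>p\<close> holds the coordinates of a
  functional with respect to the basis dual to the \<open>y\<^sub>j\<close>.\<close>

definition proj_line :: "'k::field ^ yidx \<Rightarrow> 'k ^ yidx \<Rightarrow> ('k ^ yidx) set set" where
  "proj_line l l' =
     {pt p |p. p \<noteq> 0 \<and> (\<Sum>j\<in>UNIV. l $ j * p $ j) = 0 \<and> (\<Sum>j\<in>UNIV. l' $ j * p $ j) = 0}"

definition commuting_line :: "'k::field \<Rightarrow> 'k \<Rightarrow> 'k \<Rightarrow> ('k ^ yidx) set set \<Rightarrow> bool" where
  "commuting_line \<alpha> \<beta> \<gamma> L \<longleftrightarrow>
     (\<exists>l l'. vec.dim {l, l'} = 2 \<and> L = proj_line l l' \<and>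
        lin_elem \<alpha> \<beta> \<gamma> l \<otimes>\<^bsub>alg_A \<alpha> \<beta> \<gamma>\<^esub> lin_elem \<alpha> \<beta> \<gamma> l' =
        lin_elem \<alpha> \<beta> \<gamma> l' \<otimes>\<^bsub>alg_A \<alpha> \<beta> \<gamma>\<^esub> lin_elem \<alpha> \<beta> \<gamma> l)"


section \<open>Pluecker coordinates and the conic\<close>

datatype zidx = Z01 | Z02 | Z03 | Z12 | Z13 | Z23

instance zidx :: finite
proof
  have "(UNIV :: zidx set) \<subseteq> {Z01, Z02, Z03, Z12, Z13, Z23}"
    by (auto intro: zidx.exhaust)
  then show "finite (UNIV :: zidx set)"
    by (rule finite_subset) simp
qed

definition zvec :: "'k \<Rightarrow> 'k \<Rightarrow> 'k \<Rightarrow> 'k \<Rightarrow> 'k \<Rightarrow> 'k \<Rightarrow> 'k ^ zidx" where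
  "zvec z01 z02 z03 z12 z13 z23 =
     (\<chi> i. case i of Z01 \<Rightarrow> z01 | Z02 \<Rightarrow> z02 | Z03 \<Rightarrow> z03 | Z12 \<Rightarrow> z12 | Z13 \<Rightarrow> z13 | Z23 \<Rightarrow> z23)"

definition pluecker :: "'k::field ^ yidx \<Rightarrow> 'k ^ yidx \<Rightarrow> 'k ^ zidx" where
  "pluecker l l' =
     (let z = (\<lambda>r s. l $ r * l' $ s - l' $ r * l $ s)
      in zvec (z I0 I1) (z I0 I2) (z I0 I3) (z I1 I2) (z I1 I3) (z I2 I3))"

text \<open>Here \<open>z\<^sub>3\<^sub>1 = - z\<^sub>1\<^sub>3\<close>.\<close>

definition C0_quadric :: "(zidx, 'k::field) mpoly" where
  "C0_quadric = mpoly_var Z01 * mpoly_var Z23 + mpoly_var Z02 * (- mpoly_var Z13)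
     + mpoly_var Z03 * mpoly_var Z12"

definition C0_linear :: "'k::field \<Rightarrow> 'k \<Rightarrow> 'k \<Rightarrow> (zidx, 'k) mpoly set" where
  "C0_linear \<alpha> \<beta> \<gamma> =
     {mpoly_var Z23 + mpoly_const \<alpha> * mpoly_var Z01,
      - mpoly_var Z13 + mpoly_const \<beta> * mpoly_var Z02,
      mpoly_var Z12 + mpoly_const \<gamma> * mpoly_var Z03}"

definition conic_C0 :: "'k::field \<Rightarrow> 'k \<Rightarrow> 'k \<Rightarrow> ('k ^ zidx) set set" where
  "conic_C0 \<alpha> \<beta> \<gamma> = proj_zeros (insert C0_quadric (C0_linear \<alpha> \<beta> \<gamma>))"

definition psi_formula :: "'k::field \<Rightarrow> 'k \<Rightarrow> 'k \<Rightarrow> 'k \<Rightarrow> 'k \<Rightarrow> 'k \<Rightarrow> 'k ^ zidx" where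
  "psi_formula a b c \<iota> s t =
     zvec (\<iota> * inverse a * (s^2 + t^2)) (2 * inverse b * s * t) (inverse c * (s^2 - t^2))
       (- c * (s^2 - t^2)) (2 * b * s * t) (- \<iota> * a * (s^2 + t^2))"

text \<open>Among the points of the conic, both coordinates vanish only at the image of \<open>(0 : 1)\<close>. As usual for
  a rational expression, the formula describes the inverse at all other points of the conic.\<close>

definition psi_inv_formula :: "'k::field \<Rightarrow> 'k \<Rightarrow> 'k \<Rightarrow> 'k \<Rightarrow> 'k ^ zidx \<Rightarrow> 'k ^ 2" where
  "psi_inv_formula a b c \<iota> z = vector [c * z $ Z03 - \<iota> * a * z $ Z01, b * z $ Z02]"

end

theory Submission
  imports Defs
begin

text \<open>
  A commutator \<open>[y, y']\<close> of two linear forms is \<open>\<Sum>\<^sub>r\<^sub>s z\<^sub>r\<^sub>s [y\<^sub>r, y\<^sub>s]\<close> with the Pluecker coordinates of the line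
  as coefficients. The relation ideal is generated in degree two, so its quadratic part is just the
  span of the six relations, three of which are antisymmetric and three symmetric. Since \<open>2 \<noteq> 0\<close>, a
  commutator lies in the span if and only if it is a combination of
  \<open>[y\<^sub>0, y\<^sub>i] - \<alpha>\<^sub>i [y\<^sub>j, y\<^sub>k]\<close>, that is, if \<open>z\<^sub>j\<^sub>k = -\<alpha>\<^sub>i z\<^sub>0\<^sub>i\<close> for all cyclic \<open>(i, j, k)\<close>
  (\<open>commutes_iff_pluecker\<close>). These are the linear equations of the conic, and every line satisfies the
  quadratic one. A line determines its pair of equations only up to a change of basis, which rescales
  the Pluecker vector, so the condition belongs to the line
  (\<open>commuting_line_iff_pluecker_on_conic\<close>).

  On the plane of the three linear equations the quadric becomes \<open>-(\<alpha>z\<^sub>0\<^sub>1\<^sup>2 + \<beta>z\<^sub>0\<^sub>2\<^sup>2 + \<gamma>z\<^sub>0\<^sub>3\<^sup>2)\<close>, a diagonal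
  form with nonzero coefficients, which gives smoothness (\<open>C0_smooth_conic\<close>). In the coordinates
  \<open>X = \<iota>az\<^sub>0\<^sub>1\<close>, \<open>Y = bz\<^sub>0\<^sub>2\<close>, \<open>W = cz\<^sub>0\<^sub>3\<close> it is the Pythagorean conic \<open>X\<^sup>2 = Y\<^sup>2 + W\<^sup>2\<close>, and \<open>\<psi>\<close> is its
  classical parametrization \<open>(s : t) \<mapsto> (-(s\<^sup>2 + t\<^sup>2) : 2st : s\<^sup>2 - t\<^sup>2)\<close>. The inverse is
  \<open>(W - X : Y)\<close> where \<open>W \<noteq> X\<close> and \<open>(Y : -(W + X))\<close> where \<open>W \<noteq> -X\<close>; these two charts cover the conic,
  so the inverse is a morphism as well (\<open>is_isomorphism_psi_map\<close>).
\<close>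

section \<open>Evaluation, derivatives and degrees of polynomials\<close>

lemma poly_mapping_additive_induct [case_names zero single add]:
  fixes f :: "'a \<Rightarrow>\<^sub>0 'b::comm_monoid_add"
  assumes zero: "P 0" and single: "\<And>m c. P (Poly_Mapping.single m c)"
    and add: "\<And>f g. P f \<Longrightarrow> P g \<Longrightarrow> P (f + g)"
  shows "P f"
proof -
  have "P (\<Sum>m\<in>K. Poly_Mapping.single m (Poly_Mapping.lookup f m))" if "finite K" for K
    using that by (induction K rule: finite_induct) (auto intro: zero single add)
  moreover have "f = (\<Sum>m\<in>Poly_Mapping.keys f. Poly_Mapping.single m (Poly_Mapping.lookup f m))"
    by (rule poly_mapping_eqI)
       (auto simp: lookup_sum lookup_single when_def in_keys_iff)
  ultimately show ?thesis by (metis finite_keys)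
qed

text \<open>Summing over an arbitrary finite superset of the support makes evaluation and
  differentiation visibly additive.\<close>

lemma mpoly_eval_superset:
  fixes f :: "('n::finite, 'k::field) mpoly"
  assumes "finite K" "Poly_Mapping.keys f \<subseteq> K"
  shows "mpoly_eval f v = (\<Sum>m\<in>K.
    Poly_Mapping.lookup f m * (\<Prod>i\<in>UNIV. (v $ i) ^ Poly_Mapping.lookup m i))"
  unfolding mpoly_eval_def
  by (rule sum.mono_neutral_left) (use assms in \<open>auto simp: in_keys_iff\<close>)

lemma mpoly_eval_add [simp]: "mpoly_eval (f + g) v = mpoly_eval f v + mpoly_eval g v"
proof -
  let ?K = "Poly_Mapping.keys f \<union> Poly_Mapping.keys g"
  have fin: "finite ?K" by simp
  show ?thesis
    by (subst (1 2 3) mpoly_eval_superset[OF fin])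
       (use keys_add[of f g] in \<open>auto simp: lookup_add distrib_right sum.distrib\<close>)
qed

lemma mpoly_eval_zero [simp]: "mpoly_eval 0 v = 0"
  by (simp add: mpoly_eval_def)

lemma mpoly_eval_uminus [simp]: "mpoly_eval (- f) v = - mpoly_eval f v"
  using mpoly_eval_add[of f "- f" v] by (simp add: add_eq_0_iff)

lemma mpoly_eval_diff [simp]: "mpoly_eval (f - g) v = mpoly_eval f v - mpoly_eval g v"
  using mpoly_eval_add[of f "- g" v] by simp

lemma mpoly_eval_single:
  "mpoly_eval (Poly_Mapping.single m c) v = c * (\<Prod>i\<in>UNIV. (v $ i) ^ Poly_Mapping.lookup m i)"
  by (cases "c = 0") (simp_all add: mpoly_eval_def)

lemma mpoly_eval_mult [simp]: "mpoly_eval (f * g) v = mpoly_eval f v * mpoly_eval g v"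
proof (induction f rule: poly_mapping_additive_induct)
  case (single m c)
  show ?case
  proof (induction g rule: poly_mapping_additive_induct)
    case (single m' c')
    then show ?case
      by (simp add: mult_single mpoly_eval_single lookup_add power_add prod.distrib)
  qed (simp_all add: distrib_left)
qed (simp_all add: distrib_right)

lemma mpoly_eval_const [simp]: "mpoly_eval (mpoly_const c) v = c"
  by (simp add: mpoly_const_def mpoly_eval_single)

lemma mpoly_eval_var [simp]: "mpoly_eval (mpoly_var i) v = v $ i"
proof -
  have "(\<Prod>j\<in>UNIV. (v $ j) ^ Poly_Mapping.lookup (Poly_Mapping.single i (1::nat)) j)
      = (\<Prod>j\<in>UNIV. if i = j then v $ j else 1)"
    by (rule prod.cong) (auto simp: lookup_single when_def)
  then show ?thesis by (simp add: mpoly_var_def mpoly_eval_single)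
qed

lemma mpoly_partial_superset:
  fixes f :: "('n, 'k::field) mpoly"
  assumes "finite K" "Poly_Mapping.keys f \<subseteq> K"
  shows "mpoly_partial i f = (\<Sum>m\<in>K. Poly_Mapping.single (m - Poly_Mapping.single i 1)
       (of_nat (Poly_Mapping.lookup m i) * Poly_Mapping.lookup f m))"
  unfolding mpoly_partial_def
  by (rule sum.mono_neutral_left) (use assms in \<open>auto simp: in_keys_iff\<close>)

lemma mpoly_partial_add [simp]:
  "mpoly_partial i (f + g) = mpoly_partial i f + mpoly_partial i g"
proof -
  let ?K = "Poly_Mapping.keys f \<union> Poly_Mapping.keys g"
  have fin: "finite ?K" by simp
  show ?thesis
    by (subst (1 2 3) mpoly_partial_superset[OF fin])
       (use keys_add[of f g] in \<open>auto simp: lookup_add distrib_left single_add sum.distrib\<close>)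
qed

lemma mpoly_partial_zero [simp]: "mpoly_partial i 0 = 0"
  by (simp add: mpoly_partial_def)

lemma mpoly_partial_uminus [simp]: "mpoly_partial i (- f) = - mpoly_partial i f"
  using mpoly_partial_add[of i f "- f"] by (simp add: add_eq_0_iff)

lemma mpoly_partial_diff [simp]:
  "mpoly_partial i (f - g) = mpoly_partial i f - mpoly_partial i g"
  using mpoly_partial_add[of i f "- g"] by simp

lemma mpoly_partial_single:
  "mpoly_partial i (Poly_Mapping.single m c) =
     Poly_Mapping.single (m - Poly_Mapping.single i 1) (of_nat (Poly_Mapping.lookup m i) * c)"
  by (cases "c = 0") (simp_all add: mpoly_partial_def)

text \<open>On monomials the Leibniz rule is \<open>(m + m')\<^sub>i = m\<^sub>i + m'\<^sub>i\<close>; lowering the \<open>i\<close>-th exponent commutes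
  with adding the other monomial as soon as \<open>m\<^sub>i > 0\<close>, and otherwise the coefficient is zero.\<close>

lemma mpoly_partial_mult:
  fixes f g :: "('n, 'k::field) mpoly"
  shows "mpoly_partial i (f * g) = mpoly_partial i f * g + f * mpoly_partial i g"
proof (induction f rule: poly_mapping_additive_induct)
  case (single m c)
  show ?case
  proof (induction g rule: poly_mapping_additive_induct)
    case (single m' c')
    have lower: "Poly_Mapping.single (p + q - Poly_Mapping.single i 1)
          (of_nat (Poly_Mapping.lookup p i) * d) =
        Poly_Mapping.single ((p - Poly_Mapping.single i 1) + q)
          (of_nat (Poly_Mapping.lookup p i) * d)" for p q :: "'n \<Rightarrow>\<^sub>0 nat" and d :: 'k
    proof (cases "Poly_Mapping.lookup p i = 0")
      case False
      then have "p + q - Poly_Mapping.single i 1 = (p - Poly_Mapping.single i 1) + q"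
        by (intro poly_mapping_eqI) (auto simp: lookup_add lookup_minus lookup_single when_def)
      then show ?thesis by simp
    qed simp
    have "of_nat (Poly_Mapping.lookup (m + m') i) * (c * c') =
        of_nat (Poly_Mapping.lookup m i) * (c * c') + of_nat (Poly_Mapping.lookup m' i) * (c * c')"
      by (simp add: lookup_add distrib_right)
    then have "mpoly_partial i (Poly_Mapping.single m c * Poly_Mapping.single m' c') =
        Poly_Mapping.single ((m - Poly_Mapping.single i 1) + m')
          (of_nat (Poly_Mapping.lookup m i) * (c * c')) +
        Poly_Mapping.single ((m' - Poly_Mapping.single i 1) + m)
          (of_nat (Poly_Mapping.lookup m' i) * (c * c'))"
      by (simp only: mult_single mpoly_partial_single single_add lower[of m m']
          lower[of m' m, unfolded add.commute[of m' m]])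
    then show ?case
      by (simp only: mult_single mpoly_partial_single add.commute[of m] mult.assoc mult.left_commute)
  qed (simp_all add: distrib_left add_ac)
qed (simp_all add: distrib_right add_ac)

lemma mpoly_partial_const [simp]: "mpoly_partial i (mpoly_const c) = 0"
  by (simp add: mpoly_const_def mpoly_partial_single)

lemma mpoly_partial_var [simp]:
  "mpoly_partial i (mpoly_var j) = (if i = j then mpoly_const 1 else 0)"
  by (simp add: mpoly_var_def mpoly_const_def mpoly_partial_single lookup_single when_def)

lemma homogeneous_var [simp]: "homogeneous 1 (mpoly_var i)" "homogeneous (Suc 0) (mpoly_var i)"
  by (simp_all add: homogeneous_def mpoly_var_def lookup_single when_def)

lemma homogeneous_const [simp]: "homogeneous 0 (mpoly_const c)"
  by (simp add: homogeneous_def mpoly_const_def)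

lemma homogeneous_uminus [simp]: "homogeneous d f \<Longrightarrow> homogeneous d (- f)"
  by (simp add: homogeneous_def)

lemma homogeneous_add [simp]: "homogeneous d f \<Longrightarrow> homogeneous d g \<Longrightarrow> homogeneous d (f + g)"
  unfolding homogeneous_def using keys_add[of f g] by blast

lemma homogeneous_diff [simp]: "homogeneous d f \<Longrightarrow> homogeneous d g \<Longrightarrow> homogeneous d (f - g)"
  using homogeneous_add[of d f "- g"] by simp

lemma homogeneous_mult:
  assumes "homogeneous d f" "homogeneous e g"
  shows "homogeneous (d + e) (f * g)"
  unfolding homogeneous_def
proof
  fix m assume "m \<in> Poly_Mapping.keys (f * g)"
  then obtain p q where "p \<in> Poly_Mapping.keys f" "q \<in> Poly_Mapping.keys g" "m = p + q"
    using keys_mult[of f g] by blast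
  then show "(\<Sum>i\<in>UNIV. Poly_Mapping.lookup m i) = d + e"
    using assms by (simp add: homogeneous_def lookup_add sum.distrib)
qed

lemma homogeneous_const_mult [simp]: "homogeneous d f \<Longrightarrow> homogeneous d (mpoly_const c * f)"
  using homogeneous_mult[OF homogeneous_const, of d f c] by simp

lemma homogeneous_var_mult_var [simp]: "homogeneous 2 (mpoly_var i * mpoly_var j)"
  using homogeneous_mult[OF homogeneous_var(1) homogeneous_var(1), of i j] by (simp add: numeral_2_eq_2)

lemma mpoly_eval_scale:
  assumes "homogeneous d f"
  shows "mpoly_eval f (r *s v) = r ^ d * mpoly_eval f v"
proof -
  have "(\<Prod>i\<in>UNIV. (r * v $ i) ^ Poly_Mapping.lookup m i)
      = r ^ d * (\<Prod>i\<in>UNIV. (v $ i) ^ Poly_Mapping.lookup m i)"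
    if "m \<in> Poly_Mapping.keys f" for m
  proof -
    have "(\<Prod>i\<in>UNIV. r ^ Poly_Mapping.lookup m i) = r ^ d"
      using assms that by (simp add: homogeneous_def power_sum[symmetric])
    then show ?thesis by (simp add: power_mult_distrib prod.distrib)
  qed
  then show ?thesis
    by (simp add: mpoly_eval_def sum_distrib_left mult.left_commute)
qed


section \<open>Points, zero loci and morphisms\<close>

lemma pt_scale [simp]: "r \<noteq> 0 \<Longrightarrow> pt (r *s v) = pt v"
  by (auto simp: pt_def vec.span_singleton image_iff) (metis field_class.field_inverse mult.assoc mult.commute mult_1)

lemma pt_eqE:
  assumes "pt v = pt w"
  obtains r where "r \<noteq> 0" "v = r *s w"
proof -
  have "v \<in> pt w" "w \<in> pt v"
    using assms vec.span_base[of v "{v}"] vec.span_base[of w "{w}"] by (simp_all add: pt_def)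
  then obtain r q where r: "v = r *s w" and q: "w = q *s v"
    unfolding pt_def vec.span_singleton by blast
  show thesis
  proof (cases "r = 0")
    case True
    then have "v = 1 *s w" using r q by simp
    then show thesis using that by (metis zero_neq_one)
  next
    case False
    then show thesis using r that by blast
  qed
qed

lemma pt_in_proj_space_iff [simp]: "pt v \<in> proj_space \<longleftrightarrow> v \<noteq> 0"
  by (auto simp: proj_space_def elim: pt_eqE)

lemma pt_in_proj_zeros_iff:
  assumes "\<And>f. f \<in> S \<Longrightarrow> \<exists>d. homogeneous d f"
  shows "pt v \<in> proj_zeros S \<longleftrightarrow> v \<noteq> 0 \<and> (\<forall>f\<in>S. mpoly_eval f v = 0)"
proof
  assume "pt v \<in> proj_zeros S"
  then obtain w where w: "pt v = pt w" "w \<noteq> 0" "\<forall>f\<in>S. mpoly_eval f w = 0"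
    by (auto simp: proj_zeros_def)
  from w(1) obtain r where "r \<noteq> 0" "v = r *s w" by (rule pt_eqE)
  moreover have "mpoly_eval f (r *s w) = 0" if "f \<in> S" for f
    using assms[OF that] w(3) that by (auto simp: mpoly_eval_scale)
  ultimately show "v \<noteq> 0 \<and> (\<forall>f\<in>S. mpoly_eval f v = 0)"
    using w(2) by simp
qed (auto simp: proj_zeros_def)

lemma proj_zeros_subset: "proj_zeros S \<subseteq> proj_space"
  by (auto simp: proj_zeros_def)

text \<open>To be a morphism it suffices to be covered by charts, each the complement of one
  hypersurface \<open>h = 0\<close>.\<close>

lemma is_morphism_by_charts:
  fixes X :: "('k::field ^ 'm::finite) set set" and Y :: "('k ^ 'n::finite) set set"
  assumes X: "X \<subseteq> proj_space" and maps: "\<And>v. pt v \<in> X \<Longrightarrow> f (pt v) \<in> Y"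
    and charts: "\<And>v. pt v \<in> X \<Longrightarrow> \<exists>h e d F. homogeneous e h \<and> mpoly_eval h v \<noteq> 0 \<and>
       (\<forall>j. homogeneous d (F j)) \<and>
       (\<forall>w. pt w \<in> X \<and> mpoly_eval h w \<noteq> 0 \<longrightarrow>
          (\<chi> j. mpoly_eval (F j) w) \<noteq> 0 \<and> f (pt w) = pt (\<chi> j. mpoly_eval (F j) w))"
  shows "is_morphism X Y f"
  unfolding is_morphism_def
proof (intro conjI ballI)
  fix P assume "P \<in> X"
  then obtain v where P: "P = pt v" using X by (auto simp: proj_space_def)
  then show "f P \<in> Y" using maps \<open>P \<in> X\<close> by simp
  obtain h e d F where h: "homogeneous e h" "mpoly_eval h v \<noteq> 0"
    and F: "\<forall>j. homogeneous d (F j)"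
      "\<forall>w. pt w \<in> X \<and> mpoly_eval h w \<noteq> 0 \<longrightarrow>
          (\<chi> j. mpoly_eval (F j) w) \<noteq> 0 \<and> f (pt w) = pt (\<chi> j. mpoly_eval (F j) w)"
    using charts[of v] \<open>P \<in> X\<close> P by blast
  let ?U = "proj_space - proj_zeros {h}"
  have U: "pt w \<in> X \<inter> ?U \<longleftrightarrow> pt w \<in> X \<and> mpoly_eval h w \<noteq> 0" for w
    using X pt_in_proj_zeros_iff[of "{h}" w] h(1) by auto
  have "zariski_open ?U" using h(1) unfolding zariski_open_def by (intro exI[of _ "{h}"]) auto
  moreover have "P \<in> ?U" using U[of v] \<open>P \<in> X\<close> P h(2) by simp
  ultimately show "\<exists>U. zariski_open U \<and> P \<in> U \<and>
      (\<exists>d F. (\<forall>j. homogeneous d (F j)) \<and> (\<forall>v. pt v \<in> X \<inter> U \<longrightarrow>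
         (\<chi> j. mpoly_eval (F j) v) \<noteq> 0 \<and> f (pt v) = pt (\<chi> j. mpoly_eval (F j) v)))"
    unfolding U[symmetric] using F by (intro exI[of _ ?U] conjI exI[of _ d] exI[of _ F]) (simp_all only: U, simp_all)
qed

definition proj_map :: "('k::field ^ 'm \<Rightarrow> 'k ^ 'n) \<Rightarrow> ('k ^ 'm) set \<Rightarrow> ('k ^ 'n) set" where
  "proj_map f P = pt (f (SOME v. P = pt v))"

text \<open>Homogeneity makes the choice of a representative irrelevant.\<close>

lemma proj_map_pt:
  assumes "\<And>r v. f (r *s v) = r ^ d *s f v"
  shows "proj_map f (pt v) = pt (f v)"
proof -
  have "pt v = pt (SOME w. pt v = pt w)" by (rule someI) simp
  then obtain r where "r \<noteq> 0" "v = r *s (SOME w. pt v = pt w)" by (rule pt_eqE)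
  then have "f v = r ^ d *s f (SOME w. pt v = pt w)" using assms by metis
  then show ?thesis using \<open>r \<noteq> 0\<close> by (simp add: proj_map_def)
qed

section \<open>The conic\<close>

lemma UNIV_zidx: "(UNIV :: zidx set) = {Z01, Z02, Z03, Z12, Z13, Z23}"
proof (rule Set.set_eqI)
  fix i show "i \<in> UNIV \<longleftrightarrow> i \<in> {Z01, Z02, Z03, Z12, Z13, Z23}" by (cases i) simp_all
qed

lemma zvec_nth [simp]:
  "zvec p q r s t u $ Z01 = p" "zvec p q r s t u $ Z02 = q" "zvec p q r s t u $ Z03 = r"
  "zvec p q r s t u $ Z12 = s" "zvec p q r s t u $ Z13 = t" "zvec p q r s t u $ Z23 = u"
  by (simp_all add: zvec_def)

lemma zvec_eq_iff:
  "v = w \<longleftrightarrow> v $ Z01 = w $ Z01 \<and> v $ Z02 = w $ Z02 \<and> v $ Z03 = w $ Z03 \<and>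
     v $ Z12 = w $ Z12 \<and> v $ Z13 = w $ Z13 \<and> v $ Z23 = w $ Z23"
proof -
  have "v = w \<longleftrightarrow> (\<forall>i\<in>UNIV. v $ i = w $ i)" by (simp add: vec_eq_iff)
  then show ?thesis by (simp only: UNIV_zidx ball_simps simp_thms)
qed

lemma homogeneous_C0_quadric: "homogeneous 2 C0_quadric"
proof -
  have "homogeneous (1 + 1) (mpoly_var Z02 * (- mpoly_var Z13) :: (zidx, 'a) mpoly)"
    by (rule homogeneous_mult) simp_all
  then show ?thesis unfolding C0_quadric_def one_add_one
    by (intro homogeneous_add homogeneous_var_mult_var)
qed

lemma homogeneous_C0_linear: "f \<in> C0_linear \<alpha> \<beta> \<gamma> \<Longrightarrow> homogeneous 1 f"
  by (auto simp: C0_linear_def)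

definition on_conic :: "'k::field \<Rightarrow> 'k \<Rightarrow> 'k \<Rightarrow> 'k ^ zidx \<Rightarrow> bool" where
  "on_conic \<alpha> \<beta> \<gamma> z \<longleftrightarrow>
     z $ Z01 * z $ Z23 - z $ Z02 * z $ Z13 + z $ Z03 * z $ Z12 = 0 \<and>
     z $ Z23 = - \<alpha> * z $ Z01 \<and> z $ Z13 = \<beta> * z $ Z02 \<and> z $ Z12 = - \<gamma> * z $ Z03"

lemma on_conic_iff_mpoly_eval:
  fixes \<alpha> \<beta> \<gamma> :: "'a::field"
  shows
  "on_conic \<alpha> \<beta> \<gamma> z \<longleftrightarrow> (\<forall>f\<in>insert C0_quadric (C0_linear \<alpha> \<beta> \<gamma>). mpoly_eval f z = 0)"
proof -
  have "(\<forall>f\<in>insert C0_quadric (C0_linear \<alpha> \<beta> \<gamma>). mpoly_eval f z = 0) \<longleftrightarrow>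
     z $ Z01 * z $ Z23 - z $ Z02 * z $ Z13 + z $ Z03 * z $ Z12 = 0 \<and>
     z $ Z23 + \<alpha> * z $ Z01 = 0 \<and> - z $ Z13 + \<beta> * z $ Z02 = 0 \<and> z $ Z12 + \<gamma> * z $ Z03 = 0"
    by (simp add: C0_quadric_def C0_linear_def)
  moreover have "x + e * y = 0 \<longleftrightarrow> x = - e * y" "- x + e * y = 0 \<longleftrightarrow> x = e * y" for x y e :: 'a
    by (simp_all add: eq_neg_iff_add_eq_0) (metis add.inverse_inverse add_eq_0_iff)
  ultimately show ?thesis by (simp only: on_conic_def)
qed

lemma pt_in_conic_iff: "pt z \<in> conic_C0 \<alpha> \<beta> \<gamma> \<longleftrightarrow> z \<noteq> 0 \<and> on_conic \<alpha> \<beta> \<gamma> z"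
  unfolding conic_C0_def on_conic_iff_mpoly_eval
  by (rule pt_in_proj_zeros_iff) (use homogeneous_C0_quadric homogeneous_C0_linear in blast)

text \<open>On the plane cut out by the linear forms, \<open>z\<^sub>0\<^sub>1, z\<^sub>0\<^sub>2, z\<^sub>0\<^sub>3\<close> are coordinates.\<close>

lemma dim_C0_plane:
  "vec.dim {v :: 'k::field ^ zidx. \<forall>l\<in>C0_linear \<alpha> \<beta> \<gamma>. mpoly_eval l v = 0} = 3"
proof -
  let ?u = "zvec 1 0 0 0 0 (- \<alpha>)" and ?v = "zvec 0 1 0 0 \<beta> 0" and ?w = "zvec 0 0 1 (- \<gamma>) 0 0"
  have "{v. \<forall>l\<in>C0_linear \<alpha> \<beta> \<gamma>. mpoly_eval l v = 0} = vec.span {?u, ?v, ?w}"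
  proof (rule Set.set_eqI)
    fix z :: "'k ^ zidx"
    have "(\<forall>l\<in>C0_linear \<alpha> \<beta> \<gamma>. mpoly_eval l z = 0) \<longleftrightarrow>
        z - z $ Z01 *s ?u - z $ Z02 *s ?v - z $ Z03 *s ?w = 0"
      by (auto simp: C0_linear_def zvec_eq_iff algebra_simps)
    also have "\<dots> \<longleftrightarrow> (\<exists>p q r. z - p *s ?u - q *s ?v - r *s ?w = 0)"
      by (auto simp: zvec_eq_iff)
    finally show "z \<in> {v. \<forall>l\<in>C0_linear \<alpha> \<beta> \<gamma>. mpoly_eval l v = 0} \<longleftrightarrow> z \<in> vec.span {?u, ?v, ?w}"
      by (simp add: vec.span_breakdown_eq)
  qed
  moreover have "?u \<notin> vec.span {?v, ?w}" "?v \<notin> vec.span {?w}" "?w \<notin> vec.span {}"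
    by (auto simp: vec.span_breakdown_eq zvec_eq_iff)
  ultimately show ?thesis by (simp add: vec.dim_insert)
qed

text \<open>Restricted to the plane, the quadric is \<open>-(\<alpha> z\<^sub>0\<^sub>1\<^sup>2 + \<beta> z\<^sub>0\<^sub>2\<^sup>2 + \<gamma> z\<^sub>0\<^sub>3\<^sup>2)\<close>, a nondegenerate diagonal
  form. In terms of Jacobians: if the gradient of the quadric at \<open>v\<close> is a combination of the
  gradients of the linear forms, then comparing coefficients gives the equations of the plane with
  the opposite signs, so \<open>2\<alpha>v\<^sub>0\<^sub>1 = 2\<beta>v\<^sub>0\<^sub>2 = 2\<gamma>v\<^sub>0\<^sub>3 = 0\<close> and \<open>v = 0\<close>.\<close>

lemma C0_smooth_conic:
  fixes \<alpha> \<beta> \<gamma> :: "'k::field"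
  assumes two: "(2 :: 'k) \<noteq> 0" and nz: "\<alpha> \<noteq> 0" "\<beta> \<noteq> 0" "\<gamma> \<noteq> 0"
  shows "defines_smooth_conic C0_quadric (C0_linear \<alpha> \<beta> \<gamma>)"
  unfolding defines_smooth_conic_def
proof (intro conjI allI impI)
  fix v :: "'k ^ zidx"
  assume "v \<noteq> 0 \<and> (\<forall>f\<in>insert C0_quadric (C0_linear \<alpha> \<beta> \<gamma>). mpoly_eval f v = 0)"
  then have "v \<noteq> 0" and v: "on_conic \<alpha> \<beta> \<gamma> v"
    unfolding on_conic_iff_mpoly_eval by simp_all
  let ?u1 = "zvec \<alpha> 0 0 0 0 1" and ?u2 = "zvec 0 \<beta> 0 0 (-1) 0" and ?u3 = "zvec 0 0 \<gamma> 1 0 0"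
  let ?q = "zvec (v $ Z23) (- v $ Z13) (v $ Z12) (v $ Z03) (- v $ Z02) (v $ Z01)"
  have "(\<lambda>f. mpoly_gradient f v) ` insert C0_quadric (C0_linear \<alpha> \<beta> \<gamma>) = {?q, ?u1, ?u2, ?u3}"
  proof -
    have "mpoly_gradient C0_quadric v = ?q"
      by (simp add: zvec_eq_iff mpoly_gradient_def C0_quadric_def mpoly_partial_mult)
    moreover have "(\<lambda>f. mpoly_gradient f v) ` C0_linear \<alpha> \<beta> \<gamma> = {?u1, ?u2, ?u3}"
    proof -
      have "mpoly_gradient (mpoly_var Z23 + mpoly_const \<alpha> * mpoly_var Z01) v = ?u1"
        "mpoly_gradient (- mpoly_var Z13 + mpoly_const \<beta> * mpoly_var Z02) v = ?u2"
        "mpoly_gradient (mpoly_var Z12 + mpoly_const \<gamma> * mpoly_var Z03) v = ?u3"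
        by (simp_all add: zvec_eq_iff mpoly_gradient_def mpoly_partial_mult)
      then show ?thesis by (simp add: C0_linear_def)
    qed
    ultimately show ?thesis by simp
  qed
  moreover have "?u1 \<notin> vec.span {?u2, ?u3}" "?u2 \<notin> vec.span {?u3}" "?u3 \<notin> vec.span {}"
    by (auto simp: vec.span_breakdown_eq zvec_eq_iff)
  moreover have "?q \<notin> vec.span {?u1, ?u2, ?u3}"
  proof
    assume "?q \<in> vec.span {?u1, ?u2, ?u3}"
    then have q: "v $ Z23 = \<alpha> * v $ Z01" "- v $ Z13 = \<beta> * v $ Z02" "v $ Z12 = \<gamma> * v $ Z03"
      by (auto simp: vec.span_breakdown_eq zvec_eq_iff algebra_simps)
    have v': "- v $ Z23 = \<alpha> * v $ Z01" "v $ Z13 = \<beta> * v $ Z02" "- v $ Z12 = \<gamma> * v $ Z03"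
      using v by (simp_all add: on_conic_def)
    have double: "e * x = 0" if "y = e * x" "- y = e * x" for e x y :: 'k
    proof -
      have "2 * (e * x) = y + - y" using that by (simp only: mult_2)
      then show ?thesis using two by simp
    qed
    have "\<alpha> * v $ Z01 = 0" "\<beta> * v $ Z02 = 0" "\<gamma> * v $ Z03 = 0"
      using double[OF q(1) v'(1)] double[OF v'(2) q(2)] double[OF q(3) v'(3)] by simp_all
    then show False
      using two nz v \<open>v \<noteq> 0\<close> by (simp add: on_conic_def zvec_eq_iff)
  qed
  ultimately show "vec.dim ((\<lambda>f. mpoly_gradient f v) ` insert C0_quadric (C0_linear \<alpha> \<beta> \<gamma>)) =
      CARD(zidx) - 2"
    by (simp add: vec.dim_insert UNIV_zidx)
next
  show "vec.dim {v. \<forall>l\<in>C0_linear \<alpha> \<beta> \<gamma>. mpoly_eval l v = 0} = 3" by (rule dim_C0_plane)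
qed (auto intro: homogeneous_C0_quadric homogeneous_C0_linear simp del: One_nat_def)

section \<open>Commutators in the algebra\<close>

lemma UNIV_yidx: "(UNIV :: yidx set) = {I0, I1, I2, I3}"
proof (rule Set.set_eqI)
  fix i show "i \<in> UNIV \<longleftrightarrow> i \<in> {I0, I1, I2, I3}" by (cases i) simp_all
qed

lemma sum_yidx: "(\<Sum>i\<in>UNIV. f i) = f I0 + (f I1 + (f I2 + f I3))"
  by (simp add: UNIV_yidx)

text \<open>A word factors uniquely at each position, so products in the free algebra are
  convolutions over the cutting points.\<close>

lemma lookup_mult_wrd:
  fixes f g :: "'a wrd \<Rightarrow>\<^sub>0 'k::field"
  shows "Poly_Mapping.lookup (f * g) (Wrd xs) = (\<Sum>n\<le>length xs.
    Poly_Mapping.lookup f (Wrd (take n xs)) * Poly_Mapping.lookup g (Wrd (drop n xs)))"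
proof (induction f rule: poly_mapping_additive_induct)
  case (single u c)
  show ?case
  proof (induction g rule: poly_mapping_additive_induct)
    case (single v d)
    obtain us vs where uv: "u = Wrd us" "v = Wrd vs" by (cases u, cases v)
    have cut: "(us = take n xs \<and> vs = drop n xs) \<longleftrightarrow> n = length us \<and> us @ vs = xs"
      if "n \<le> length xs" for n
      using that by (auto simp: min_def)
    have "(\<Sum>n\<le>length xs. Poly_Mapping.lookup (Poly_Mapping.single u c) (Wrd (take n xs)) *
          Poly_Mapping.lookup (Poly_Mapping.single v d) (Wrd (drop n xs)))
        = (\<Sum>n\<le>length xs. if n = length us then (if us @ vs = xs then c * d else 0) else 0)"
    proof (rule sum.cong[OF refl])
      fix n assume "n \<in> {..length xs}"
      then have n: "n \<le> length xs" by simp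
      have "Poly_Mapping.lookup (Poly_Mapping.single u c) (Wrd (take n xs)) *
          Poly_Mapping.lookup (Poly_Mapping.single v d) (Wrd (drop n xs)) =
          (if us = take n xs \<and> vs = drop n xs then c * d else 0)"
        by (simp add: lookup_single uv when_def)
      also have "\<dots> = (if n = length us then (if us @ vs = xs then c * d else 0) else 0)"
        unfolding cut[OF n] by simp
      finally show "Poly_Mapping.lookup (Poly_Mapping.single u c) (Wrd (take n xs)) *
          Poly_Mapping.lookup (Poly_Mapping.single v d) (Wrd (drop n xs)) =
          (if n = length us then (if us @ vs = xs then c * d else 0) else 0)" .
    qed
    also have "\<dots> = (if us @ vs = xs then c * d else 0)" by auto
    finally show ?case
      by (auto simp: mult_single lookup_single uv plus_wrd_def when_def)
  qed (simp_all add: lookup_add distrib_left sum.distrib)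
qed (simp_all add: lookup_add distrib_right sum.distrib)

lemma scalar_add: "scalar (c + d) = scalar c + scalar d"
  by (simp add: scalar_def single_add)

lemma scalar_uminus: "scalar (- c) = - scalar c"
  by (simp add: scalar_def single_uminus)

lemma scalar_mult: "scalar (c * d) = scalar c * scalar d"
  by (simp add: scalar_def mult_single)

lemma scalar_central: "f * scalar c = scalar c * (f :: 'k::field free_alg)"
proof (induction f rule: poly_mapping_additive_induct)
  case (single w d)
  then show ?case by (simp add: scalar_def mult_single mult.commute)
qed (simp_all add: distrib_left distrib_right)

lemma lookup_scalar_mult: "Poly_Mapping.lookup (scalar c * f) (Wrd xs) = c * Poly_Mapping.lookup f (Wrd xs)"
proof -
  have "(\<Sum>n\<le>length xs. Poly_Mapping.lookup (scalar c) (Wrd (take n xs)) * Poly_Mapping.lookup f (Wrd (drop n xs)))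
      = (\<Sum>n\<le>length xs. if n = 0 then c * Poly_Mapping.lookup f (Wrd xs) else 0)"
    by (rule sum.cong) (auto simp: scalar_def lookup_single zero_wrd_def when_def)
  then show ?thesis by (simp add: lookup_mult_wrd)
qed

lemma ring_free_ring: "ring free_ring"
proof (rule ringI)
  show "abelian_group (free_ring :: 'k::field free_alg ring)"
  proof (rule abelian_groupI)
    fix x :: "'k free_alg"
    show "\<exists>y\<in>carrier free_ring. y \<oplus>\<^bsub>free_ring\<^esub> x = \<zero>\<^bsub>free_ring\<^esub>"
      by (rule bexI[of _ "- x"]) (simp_all add: free_ring_def)
  qed (simp_all add: free_ring_def add_ac)
  show "Group.monoid (free_ring :: 'k::field free_alg ring)"
    by (rule monoidI) (simp_all add: free_ring_def mult.assoc)
qed (simp_all add: free_ring_def distrib_left distrib_right)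

lemma free_ring_simps [simp]:
  "carrier free_ring = UNIV" "x \<oplus>\<^bsub>free_ring\<^esub> y = x + y" "x \<otimes>\<^bsub>free_ring\<^esub> y = x * y"
  "\<zero>\<^bsub>free_ring\<^esub> = 0"
  by (simp_all add: free_ring_def)

lemma free_ring_minus [simp]: "x \<ominus>\<^bsub>free_ring\<^esub> y = x - y"
proof -
  interpret ring free_ring by (rule ring_free_ring)
  have "\<ominus>\<^bsub>free_ring\<^esub> y = - y" by (rule minus_equality) simp_all
  then show ?thesis by (simp add: a_minus_def)
qed

lemma ideal_rel_ideal: "ideal (rel_ideal \<alpha> \<beta> \<gamma>) free_ring"
  unfolding rel_ideal_def by (rule ring.genideal_ideal[OF ring_free_ring]) simp

lemma rel_ideal_add: "x \<in> rel_ideal \<alpha> \<beta> \<gamma> \<Longrightarrow> y \<in> rel_ideal \<alpha> \<beta> \<gamma> \<Longrightarrow> x + y \<in> rel_ideal \<alpha> \<beta> \<gamma>"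
  using additive_subgroup.a_closed[OF ideal.axioms(1)[OF ideal_rel_ideal]] by fastforce

lemma rel_ideal_mult: "x \<in> rel_ideal \<alpha> \<beta> \<gamma> \<Longrightarrow> r * x \<in> rel_ideal \<alpha> \<beta> \<gamma>"
  using ideal.I_l_closed[OF ideal_rel_ideal] by fastforce

lemma relations_subset_rel_ideal: "relations \<alpha> \<beta> \<gamma> \<subseteq> rel_ideal \<alpha> \<beta> \<gamma>"
  unfolding rel_ideal_def by (rule ring.genideal_self[OF ring_free_ring]) simp

definition low_degree_vanishing :: "'k::field free_alg \<Rightarrow> bool" where
  "low_degree_vanishing f \<longleftrightarrow> Poly_Mapping.lookup f (Wrd []) = 0 \<and> (\<forall>p. Poly_Mapping.lookup f (Wrd [p]) = 0)"

definition comm_functional :: "'k::field \<Rightarrow> yidx \<Rightarrow> yidx \<Rightarrow> yidx \<Rightarrow> 'k free_alg \<Rightarrow> 'k" where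
  "comm_functional e i j k f =
     Poly_Mapping.lookup f (Wrd [j, k]) - Poly_Mapping.lookup f (Wrd [k, j]) +
     e * (Poly_Mapping.lookup f (Wrd [I0, i]) - Poly_Mapping.lookup f (Wrd [i, I0]))"

text \<open>An ideal that bounds the relation ideal from above in degree two. The three functionals vanish
  on the relations, and multiplying an element without terms of degree below two changes its
  degree-two part only by a scalar, so their common kernel is stable under multiplication.\<close>

definition quadratic_ideal :: "'k::field \<Rightarrow> 'k \<Rightarrow> 'k \<Rightarrow> 'k free_alg set" where
  "quadratic_ideal \<alpha> \<beta> \<gamma> = {f. low_degree_vanishing f \<and> comm_functional \<alpha> I1 I2 I3 f = 0 \<and>
     comm_functional \<beta> I2 I3 I1 f = 0 \<and> comm_functional \<gamma> I3 I1 I2 f = 0}"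

lemma lookup_mult_two_letters:
  "Poly_Mapping.lookup (f * g) (Wrd [p, q]) =
     Poly_Mapping.lookup f (Wrd []) * Poly_Mapping.lookup g (Wrd [p, q]) +
     Poly_Mapping.lookup f (Wrd [p]) * Poly_Mapping.lookup g (Wrd [q]) +
     Poly_Mapping.lookup f (Wrd [p, q]) * Poly_Mapping.lookup g (Wrd [])"
  for f g :: "'a wrd \<Rightarrow>\<^sub>0 'k::field"
  by (simp add: lookup_mult_wrd numeral_2_eq_2)

lemma ideal_quadratic_ideal: "ideal (quadratic_ideal \<alpha> \<beta> \<gamma>) free_ring"
proof -
  have comm_mult: "comm_functional e i j k (f * g) = Poly_Mapping.lookup f (Wrd []) * comm_functional e i j k g"
      "comm_functional e i j k (g * f) = Poly_Mapping.lookup f (Wrd []) * comm_functional e i j k g"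
      "low_degree_vanishing (f * g)" "low_degree_vanishing (g * f)"
    if "low_degree_vanishing g" for e i j k and f g :: "'a free_alg"
    using that by (simp_all add: low_degree_vanishing_def comm_functional_def lookup_mult_two_letters
        lookup_mult_wrd[of _ _ "[]"] lookup_mult_wrd[of _ _ "[_]"] algebra_simps)
  show ?thesis
  proof (rule idealI)
    show "subgroup (quadratic_ideal \<alpha> \<beta> \<gamma>) (add_monoid free_ring)"
    proof (rule group.subgroupI)
      show "Group.group (add_monoid (free_ring :: 'a free_alg ring))"
        by (rule abelian_group.a_group[OF ring.is_abelian_group[OF ring_free_ring]])
      fix f :: "'a free_alg" assume f: "f \<in> quadratic_ideal \<alpha> \<beta> \<gamma>"
      have "inv\<^bsub>add_monoid free_ring\<^esub> f = - f"
        using free_ring_minus[of 0 f] by (simp add: a_minus_def a_inv_def)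
      moreover have "comm_functional e i j k (- f) = - comm_functional e i j k f" for e i j k
        by (simp add: comm_functional_def algebra_simps)
      ultimately show "inv\<^bsub>add_monoid free_ring\<^esub> f \<in> quadratic_ideal \<alpha> \<beta> \<gamma>"
        using f by (simp add: quadratic_ideal_def low_degree_vanishing_def)
      fix g assume g: "g \<in> quadratic_ideal \<alpha> \<beta> \<gamma>"
      have "comm_functional e i j k (f + g) = comm_functional e i j k f + comm_functional e i j k g" for e i j k
        by (simp add: comm_functional_def lookup_add algebra_simps)
      then show "f \<otimes>\<^bsub>add_monoid free_ring\<^esub> g \<in> quadratic_ideal \<alpha> \<beta> \<gamma>"
        using f g by (simp add: quadratic_ideal_def low_degree_vanishing_def lookup_add)
    next
      have "0 \<in> quadratic_ideal \<alpha> \<beta> \<gamma>"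
        by (simp add: quadratic_ideal_def low_degree_vanishing_def comm_functional_def)
      then show "quadratic_ideal \<alpha> \<beta> \<gamma> \<noteq> {}" by blast
    qed simp
  qed (auto simp: ring_free_ring quadratic_ideal_def comm_mult)
qed

lemma lookup_yvar_mult:
  "Poly_Mapping.lookup (yvar i * yvar j :: 'k::field free_alg) (Wrd xs) = (if xs = [i, j] then 1 else 0)"
  by (auto simp: yvar_def mult_single lookup_single plus_wrd_def when_def)

lemma relations_eq:
  "relations \<alpha> \<beta> \<gamma> =
    {(yvar I0 * yvar I1 - yvar I1 * yvar I0) - scalar \<alpha> * (yvar I2 * yvar I3 - yvar I3 * yvar I2),
     (yvar I0 * yvar I1 + yvar I1 * yvar I0) - (yvar I2 * yvar I3 + yvar I3 * yvar I2),
     (yvar I0 * yvar I2 - yvar I2 * yvar I0) - scalar \<beta> * (yvar I3 * yvar I1 - yvar I1 * yvar I3),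
     (yvar I0 * yvar I2 + yvar I2 * yvar I0) - (yvar I3 * yvar I1 + yvar I1 * yvar I3),
     (yvar I0 * yvar I3 - yvar I3 * yvar I0) - scalar \<gamma> * (yvar I1 * yvar I2 - yvar I2 * yvar I1),
     (yvar I0 * yvar I3 + yvar I3 * yvar I0) - (yvar I1 * yvar I2 + yvar I2 * yvar I1)}"
  by (simp add: relations_def insert_commute)

lemma rel_ideal_subset_quadratic_ideal: "rel_ideal \<alpha> \<beta> \<gamma> \<subseteq> quadratic_ideal \<alpha> \<beta> \<gamma>"
  unfolding rel_ideal_def
  by (rule ring.genideal_minimal[OF ring_free_ring ideal_quadratic_ideal])
     (simp add: relations_eq quadratic_ideal_def low_degree_vanishing_def comm_functional_def
       lookup_minus lookup_add lookup_scalar_mult lookup_yvar_mult)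

definition commutes_in_A :: "'k::field \<Rightarrow> 'k \<Rightarrow> 'k \<Rightarrow> 'k ^ yidx \<Rightarrow> 'k ^ yidx \<Rightarrow> bool" where
  "commutes_in_A \<alpha> \<beta> \<gamma> l l' \<longleftrightarrow>
     lin_elem \<alpha> \<beta> \<gamma> l \<otimes>\<^bsub>alg_A \<alpha> \<beta> \<gamma>\<^esub> lin_elem \<alpha> \<beta> \<gamma> l' =
     lin_elem \<alpha> \<beta> \<gamma> l' \<otimes>\<^bsub>alg_A \<alpha> \<beta> \<gamma>\<^esub> lin_elem \<alpha> \<beta> \<gamma> l"

definition free_lin :: "'k::field ^ yidx \<Rightarrow> 'k free_alg" where
  "free_lin l = (\<Sum>j\<in>UNIV. scalar (l $ j) * yvar j)"

lemma commutes_iff_commutator_in_rel_ideal: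
  "commutes_in_A \<alpha> \<beta> \<gamma> l l' \<longleftrightarrow> free_lin l * free_lin l' - free_lin l' * free_lin l \<in> rel_ideal \<alpha> \<beta> \<gamma>"
proof -
  interpret ideal "rel_ideal \<alpha> \<beta> \<gamma>" free_ring by (rule ideal_rel_ideal)
  have "lin_elem \<alpha> \<beta> \<gamma> u \<otimes>\<^bsub>alg_A \<alpha> \<beta> \<gamma>\<^esub> lin_elem \<alpha> \<beta> \<gamma> v =
      rel_ideal \<alpha> \<beta> \<gamma> +>\<^bsub>free_ring\<^esub> free_lin u * free_lin v" for u v
    using rcoset_mult_add[of "free_lin u" "free_lin v"]
    by (simp add: alg_A_def FactRing_def lin_elem_def free_lin_def)
  then show ?thesis
    using quotient_eq_iff_same_a_r_cos[OF ideal_rel_ideal,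
        of "free_lin l * free_lin l'" "free_lin l' * free_lin l" \<alpha> \<beta> \<gamma>]
    by (simp add: commutes_in_A_def)
qed

text \<open>Exchanging the summation indices in the second product gives \<open>\<Sum>\<^sub>i\<^sub>j l\<^sub>i l'\<^sub>j [y\<^sub>i, y\<^sub>j]\<close>, and the
  antisymmetry of the bracket collects the terms for \<open>(i, j)\<close> and \<open>(j, i)\<close> into one minor.\<close>

lemma commutator_expansion:
  fixes l l' :: "'k::field ^ yidx"
  defines "z \<equiv> pluecker l l'"
  shows "free_lin l * free_lin l' - free_lin l' * free_lin l =
    scalar (z $ Z01) * (yvar I0 * yvar I1 - yvar I1 * yvar I0) +
    scalar (z $ Z02) * (yvar I0 * yvar I2 - yvar I2 * yvar I0) +
    scalar (z $ Z03) * (yvar I0 * yvar I3 - yvar I3 * yvar I0) +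
    scalar (z $ Z12) * (yvar I1 * yvar I2 - yvar I2 * yvar I1) +
    scalar (z $ Z13) * (yvar I1 * yvar I3 - yvar I3 * yvar I1) +
    scalar (z $ Z23) * (yvar I2 * yvar I3 - yvar I3 * yvar I2)"
proof -
  have prod: "free_lin u * free_lin v =
      (\<Sum>i\<in>UNIV. \<Sum>j\<in>UNIV. scalar (u $ i * v $ j) * (yvar i * yvar j))" for u v :: "'k ^ yidx"
  proof -
    have "scalar c * yvar i * (scalar d * yvar j) = scalar (c * d) * (yvar i * yvar j)" for c d :: 'k and i j
    proof -
      have "scalar c * yvar i * (scalar d * yvar j) = scalar c * (yvar i * scalar d) * yvar j"
        by (simp only: mult.assoc)
      also have "\<dots> = scalar (c * d) * (yvar i * yvar j)"
        by (simp only: scalar_central[of "yvar i" d] scalar_mult mult.assoc)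
      finally show ?thesis .
    qed
    then show ?thesis by (simp add: free_lin_def sum_product)
  qed
  define K :: "yidx \<Rightarrow> yidx \<Rightarrow> 'k free_alg" where "K i j = yvar i * yvar j - yvar j * yvar i" for i j
  have K: "K i i = 0" "K I1 I0 = - K I0 I1" "K I2 I0 = - K I0 I2" "K I3 I0 = - K I0 I3"
    "K I2 I1 = - K I1 I2" "K I3 I1 = - K I1 I3" "K I3 I2 = - K I2 I3" for i
    by (simp_all add: K_def)
  have minus: "scalar (c - d) * Y = scalar c * Y - scalar d * Y" for c d :: 'k and Y
    using scalar_add[of c "- d"] by (simp add: scalar_uminus left_diff_distrib)
  have "free_lin l' * free_lin l = (\<Sum>i\<in>UNIV. \<Sum>j\<in>UNIV. scalar (l $ i * l' $ j) * (yvar j * yvar i))"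
    unfolding prod by (subst sum.swap) (simp add: mult.commute)
  then have "free_lin l * free_lin l' - free_lin l' * free_lin l =
      (\<Sum>i\<in>UNIV. \<Sum>j\<in>UNIV. scalar (l $ i * l' $ j) * K i j)"
    by (simp add: prod[of l l'] K_def right_diff_distrib sum_subtractf)
  also have "\<dots> = scalar (z $ Z01) * K I0 I1 + scalar (z $ Z02) * K I0 I2 + scalar (z $ Z03) * K I0 I3 +
      scalar (z $ Z12) * K I1 I2 + scalar (z $ Z13) * K I1 I3 + scalar (z $ Z23) * K I2 I3"
    unfolding sum_yidx K z_def pluecker_def Let_def zvec_nth minus
    by (simp add: mult.commute[of "l' $ _" "l $ _"])
  finally show ?thesis by (simp only: K_def)
qed

text \<open>For one direction, the three functionals take the values \<open>2(z\<^sub>j\<^sub>k + \<alpha>\<^sub>i z\<^sub>0\<^sub>i)\<close> on the commutator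
  and vanish on the relation ideal. Conversely, under these equations the commutator is the
  combination of the antisymmetric relations with coefficients \<open>z\<^sub>0\<^sub>i\<close>.\<close>

lemma commutes_iff_pluecker:
  fixes l l' :: "'k::field ^ yidx"
  assumes two: "(2 :: 'k) \<noteq> 0"
  shows "commutes_in_A \<alpha> \<beta> \<gamma> l l' \<longleftrightarrow> pluecker l l' $ Z23 = - \<alpha> * pluecker l l' $ Z01 \<and>
    pluecker l l' $ Z13 = \<beta> * pluecker l l' $ Z02 \<and> pluecker l l' $ Z12 = - \<gamma> * pluecker l l' $ Z03"
    (is "_ \<longleftrightarrow> ?lin")
proof -
  define z where "z = pluecker l l'"
  define C where "C = free_lin l * free_lin l' - free_lin l' * free_lin l"
  note C = commutator_expansion[of l l', folded z_def C_def]
  have "?lin" if "C \<in> rel_ideal \<alpha> \<beta> \<gamma>"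
  proof -
    have "comm_functional \<alpha> I1 I2 I3 C = 0" "comm_functional \<beta> I2 I3 I1 C = 0"
        "comm_functional \<gamma> I3 I1 I2 C = 0"
      using that rel_ideal_subset_quadratic_ideal by (auto simp: quadratic_ideal_def)
    moreover have "comm_functional \<alpha> I1 I2 I3 C = 2 * (z $ Z23 + \<alpha> * z $ Z01)"
        "comm_functional \<beta> I2 I3 I1 C = 2 * (\<beta> * z $ Z02 - z $ Z13)"
        "comm_functional \<gamma> I3 I1 I2 C = 2 * (z $ Z12 + \<gamma> * z $ Z03)"
      by (simp_all add: comm_functional_def C lookup_minus lookup_add lookup_scalar_mult
          lookup_yvar_mult algebra_simps)
    ultimately have "z $ Z23 + \<alpha> * z $ Z01 = 0" "\<beta> * z $ Z02 - z $ Z13 = 0" "z $ Z12 + \<gamma> * z $ Z03 = 0"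
      using two by (metis mult_eq_0_iff)+
    then show ?thesis by (simp add: z_def eq_neg_iff_add_eq_0)
  qed
  moreover have "C \<in> rel_ideal \<alpha> \<beta> \<gamma>" if ?lin
  proof -
    have "C = scalar (z $ Z01) * ((yvar I0 * yvar I1 - yvar I1 * yvar I0)
            - scalar \<alpha> * (yvar I2 * yvar I3 - yvar I3 * yvar I2))
        + scalar (z $ Z02) * ((yvar I0 * yvar I2 - yvar I2 * yvar I0)
            - scalar \<beta> * (yvar I3 * yvar I1 - yvar I1 * yvar I3))
        + scalar (z $ Z03) * ((yvar I0 * yvar I3 - yvar I3 * yvar I0)
            - scalar \<gamma> * (yvar I1 * yvar I2 - yvar I2 * yvar I1))"
    proof -
      have "z $ Z23 = - (\<alpha> * z $ Z01)" "z $ Z13 = \<beta> * z $ Z02" "z $ Z12 = - (\<gamma> * z $ Z03)"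
        using that by (simp_all add: z_def)
      moreover have "scalar c * (scalar e * Y) = scalar (e * c) * Y" for c e :: 'k and Y
        using scalar_central[of "scalar e" c] by (simp only: scalar_mult mult.assoc[symmetric])
      ultimately show ?thesis
        unfolding C by (simp add: scalar_uminus right_diff_distrib)
    qed
    moreover have "x \<in> rel_ideal \<alpha> \<beta> \<gamma>" if "x \<in> relations \<alpha> \<beta> \<gamma>" for x
      using that relations_subset_rel_ideal by blast
    ultimately show ?thesis
      by (simp only: relations_eq insert_iff simp_thms rel_ideal_add rel_ideal_mult)
  qed
  ultimately show ?thesis
    unfolding commutes_iff_commutator_in_rel_ideal C_def by blast
qed

section \<open>Independence of the chosen equations of a line\<close>

lemma pluecker_nth:
  "pluecker l l' $ Z01 = l $ I0 * l' $ I1 - l' $ I0 * l $ I1"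
  "pluecker l l' $ Z02 = l $ I0 * l' $ I2 - l' $ I0 * l $ I2"
  "pluecker l l' $ Z03 = l $ I0 * l' $ I3 - l' $ I0 * l $ I3"
  "pluecker l l' $ Z12 = l $ I1 * l' $ I2 - l' $ I1 * l $ I2"
  "pluecker l l' $ Z13 = l $ I1 * l' $ I3 - l' $ I1 * l $ I3"
  "pluecker l l' $ Z23 = l $ I2 * l' $ I3 - l' $ I2 * l $ I3"
  by (simp_all add: pluecker_def Let_def)

lemma nonzero_minor_if_dim_2:
  fixes l l' :: "'k::field ^ 'n::finite"
  assumes dim: "vec.dim {l, l'} = 2"
  obtains r s where "l $ r * l' $ s - l' $ r * l $ s \<noteq> 0"
proof -
  have "\<exists>r s. l $ r * l' $ s - l' $ r * l $ s \<noteq> 0"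
  proof (rule ccontr)
    assume "\<not> ?thesis"
    then have eq: "l $ r * l' $ s = l' $ r * l $ s" for r s by simp
    have dims: "vec.dim {l, l'} \<le> card {l}" if "{l, l'} \<subseteq> vec.span {l}"
      using that by (intro vec.dim_le_card) simp_all
    have dims': "vec.dim {l, l'} \<le> card {l'}" if "{l, l'} \<subseteq> vec.span {l'}"
      using that by (intro vec.dim_le_card) simp_all
    show False
    proof (cases "l = 0")
      case True
      then show False using dims' dim by (simp add: vec.span_base vec.span_zero)
    next
      case False
      then obtain r where r: "l $ r \<noteq> 0" by (auto simp: vec_eq_iff)
      then have "l' = (l' $ r / l $ r) *s l"
        unfolding vec_eq_iff vector_smult_component using eq[of r]
        by (metis mult.commute nonzero_eq_divide_eq times_divide_eq_left)
      then have "l' \<in> vec.span {l}" by (metis vec.span_base vec.span_scale singletonI)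
      then show False using dims dim by (simp add: vec.span_base)
    qed
  qed
  then show thesis using that by blast
qed

lemma pluecker_nonzero:
  fixes l l' :: "'k::field ^ yidx"
  assumes "vec.dim {l, l'} = 2"
  shows "pluecker l l' \<noteq> 0"
proof
  assume "pluecker l l' = 0"
  then have eq: "l $ I0 * l' $ I1 = l' $ I0 * l $ I1" "l $ I0 * l' $ I2 = l' $ I0 * l $ I2"
    "l $ I0 * l' $ I3 = l' $ I0 * l $ I3" "l $ I1 * l' $ I2 = l' $ I1 * l $ I2"
    "l $ I1 * l' $ I3 = l' $ I1 * l $ I3" "l $ I2 * l' $ I3 = l' $ I2 * l $ I3"
    by (simp_all add: zvec_eq_iff pluecker_nth)
  obtain r s where "l $ r * l' $ s - l' $ r * l $ s \<noteq> 0"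
    using assms by (rule nonzero_minor_if_dim_2)
  moreover have "l $ r * l' $ s = l' $ r * l $ s"
    using eq by (cases r; cases s) (simp_all only: mult.commute[of "l $ _" "l' $ _"])
  ultimately show False by simp
qed

lemma pluecker_quadric:
  "pluecker l l' $ Z01 * pluecker l l' $ Z23 - pluecker l l' $ Z02 * pluecker l l' $ Z13 +
    pluecker l l' $ Z03 * pluecker l l' $ Z12 = 0"
  by (simp add: pluecker_nth algebra_simps)

lemma annihilates_if_proj_line_eq:
  assumes line: "proj_line l l' = proj_line m m'"
    and p: "(\<Sum>j\<in>UNIV. l $ j * p $ j) = 0" "(\<Sum>j\<in>UNIV. l' $ j * p $ j) = 0"
  shows "(\<Sum>j\<in>UNIV. m $ j * p $ j) = 0" "(\<Sum>j\<in>UNIV. m' $ j * p $ j) = 0"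
proof -
  have "(\<Sum>j\<in>UNIV. m $ j * p $ j) = 0 \<and> (\<Sum>j\<in>UNIV. m' $ j * p $ j) = 0"
  proof (cases "p = 0")
    case False
    then have "pt p \<in> proj_line m m'"
      unfolding line[symmetric] unfolding proj_line_def using p by (auto intro!: exI[of _ p])
    then obtain q where "pt p = pt q \<and> q \<noteq> 0 \<and> (\<Sum>j\<in>UNIV. m $ j * q $ j) = 0 \<and> (\<Sum>j\<in>UNIV. m' $ j * q $ j) = 0"
      unfolding proj_line_def mem_Collect_eq ..
    then have q: "pt p = pt q" "(\<Sum>j\<in>UNIV. m $ j * q $ j) = 0" "(\<Sum>j\<in>UNIV. m' $ j * q $ j) = 0"
      by simp_all
    from q(1) obtain r where "p = r *s q" by (rule pt_eqE)
    moreover have "(\<Sum>j\<in>UNIV. f $ j * (r *s q) $ j) = r * (\<Sum>j\<in>UNIV. f $ j * q $ j)" for f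
      by (simp add: sum_distrib_left mult.left_commute)
    ultimately show ?thesis using q(2,3) by simp
  qed simp
  then show "(\<Sum>j\<in>UNIV. m $ j * p $ j) = 0" "(\<Sum>j\<in>UNIV. m' $ j * p $ j) = 0" by simp_all
qed

text \<open>If \<open>l\<close> and \<open>l'\<close> have a nonzero \<open>(r, s)\<close>-minor, then any form \<open>m\<close> vanishing on their common
  zeros is a combination of them by Cramer's rule: for every \<open>t\<close> the vector supported on \<open>r, s, t\<close>
  whose entries are the complementary minors of \<open>(l, l')\<close> is a common zero, and its equation under
  \<open>m\<close> expresses \<open>m\<^sub>t\<close> through \<open>m\<^sub>r\<close> and \<open>m\<^sub>s\<close>.\<close>

lemma combination_if_vanishing_on_common_zeros:
  fixes l l' m :: "'k::field ^ 'n::finite"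
  assumes minor: "l $ r * l' $ s - l' $ r * l $ s \<noteq> 0"
    and vanish: "\<And>p. (\<Sum>j\<in>UNIV. l $ j * p $ j) = 0 \<Longrightarrow> (\<Sum>j\<in>UNIV. l' $ j * p $ j) = 0 \<Longrightarrow>
      (\<Sum>j\<in>UNIV. m $ j * p $ j) = 0"
  obtains A B where "m = A *s l + B *s l'"
proof -
  define z where "z = (\<lambda>i j. l $ i * l' $ j - l' $ i * l $ j)"
  define A where "A = (m $ r * l' $ s - m $ s * l' $ r) / z r s"
  define B where "B = (m $ s * l $ r - m $ r * l $ s) / z r s"
  have "z r s * m $ t = (m $ r * l' $ s - m $ s * l' $ r) * l $ t + (m $ s * l $ r - m $ r * l $ s) * l' $ t"
    for t
  proof -
    \<comment> \<open>adding the three contributions covers coincidences among \<open>r, s, t\<close> as well\<close>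
    define p :: "'k ^ 'n" where "p = (\<chi> u. (if u = r then z s t else 0) + (if u = s then z t r else 0) +
      (if u = t then z r s else 0))"
    have eval: "(\<Sum>j\<in>UNIV. f $ j * p $ j) = f $ r * z s t + f $ s * z t r + f $ t * z r s" for f :: "'k ^ 'n"
    proof -
      have "f $ j * p $ j = (if j = r then f $ j * z s t else 0) + (if j = s then f $ j * z t r else 0) +
          (if j = t then f $ j * z r s else 0)" for j
        by (simp add: p_def distrib_left)
      then show ?thesis by (simp add: sum.distrib)
    qed
    have "m $ r * z s t + m $ s * z t r + m $ t * z r s = 0"
      unfolding eval[symmetric]
      by (rule vanish) (simp_all add: eval z_def algebra_simps)
    moreover have "z r s * m $ t - ((m $ r * l' $ s - m $ s * l' $ r) * l $ t + (m $ s * l $ r - m $ r * l $ s) * l' $ t) =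
        m $ r * z s t + m $ s * z t r + m $ t * z r s"
      by (simp add: z_def algebra_simps)
    ultimately show ?thesis by simp
  qed
  moreover have "z r s \<noteq> 0" using minor by (simp add: z_def)
  ultimately have "m = A *s l + B *s l'"
    by (simp add: vec_eq_iff A_def B_def add_divide_distrib[symmetric] eq_divide_eq mult.commute)
  then show thesis by (rule that)
qed

lemma pluecker_combination:
  "pluecker (A *s l + B *s l') (A' *s l + B' *s l') = (A * B' - A' * B) *s pluecker l l'"
  by (simp add: zvec_eq_iff pluecker_nth algebra_simps)

lemma pluecker_proportional_if_same_line:
  assumes "vec.dim {l, l'} = 2" "proj_line l l' = proj_line m m'"
  obtains d where "pluecker m m' = d *s pluecker l l'"
proof -
  obtain r s where minor: "l $ r * l' $ s - l' $ r * l $ s \<noteq> 0"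
    using assms(1) by (rule nonzero_minor_if_dim_2)
  note vanish = annihilates_if_proj_line_eq[OF assms(2)]
  obtain A B where "m = A *s l + B *s l'"
    using combination_if_vanishing_on_common_zeros[OF minor, of m] vanish(1) by blast
  moreover obtain A' B' where "m' = A' *s l + B' *s l'"
    using combination_if_vanishing_on_common_zeros[OF minor, of m'] vanish(2) by blast
  ultimately show thesis using that pluecker_combination by blast
qed

text \<open>A commuting line comes with some commuting pair \<open>m, m'\<close> of equations. The given pair \<open>l, l'\<close>
  has a proportional Pluecker vector, and the equations of the conic are homogeneous.\<close>

lemma commuting_line_iff_pluecker_on_conic:
  fixes l l' :: "'k::field ^ yidx"
  assumes two: "(2 :: 'k) \<noteq> 0" and dim: "vec.dim {l, l'} = 2"
  shows "commuting_line \<alpha> \<beta> \<gamma> (proj_line l l') \<longleftrightarrow> pt (pluecker l l') \<in> conic_C0 \<alpha> \<beta> \<gamma>"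
proof -
  have commutes: "commutes_in_A \<alpha> \<beta> \<gamma> m m' \<longleftrightarrow> on_conic \<alpha> \<beta> \<gamma> (pluecker m m')" for m m' :: "'k ^ yidx"
    using commutes_iff_pluecker[OF two, of \<alpha> \<beta> \<gamma> m m'] pluecker_quadric[of m m']
    by (simp add: on_conic_def)
  have "on_conic \<alpha> \<beta> \<gamma> (pluecker l l')" if m: "vec.dim {m, m'} = 2" "proj_line l l' = proj_line m m'"
    "on_conic \<alpha> \<beta> \<gamma> (pluecker m m')" for m m'
  proof -
    obtain d where "pluecker l l' = d *s pluecker m m'"
      using pluecker_proportional_if_same_line[OF m(1) m(2)[symmetric]] .
    then show ?thesis
      using m(3) pluecker_quadric[of l l'] by (simp add: on_conic_def)
  qed
  then have "commuting_line \<alpha> \<beta> \<gamma> (proj_line l l') \<longleftrightarrow> on_conic \<alpha> \<beta> \<gamma> (pluecker l l')"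
    unfolding commuting_line_def commutes_in_A_def[symmetric] commutes using dim by blast
  then show ?thesis using pluecker_nonzero[OF dim] by (simp add: pt_in_conic_iff)
qed

section \<open>The parametrization\<close>

lemma vec2_eq_iff: "v = w \<longleftrightarrow> v $ 1 = w $ 1 \<and> v $ 2 = w $ 2" for v w :: "'a ^ 2"
  by (simp add: vec_eq_iff forall_2)

definition psi_vec :: "'k::field \<Rightarrow> 'k \<Rightarrow> 'k \<Rightarrow> 'k \<Rightarrow> 'k ^ 2 \<Rightarrow> 'k ^ zidx" where
  "psi_vec a b c \<iota> v = psi_formula a b c \<iota> (v $ 1) (v $ 2)"

lemma psi_vec_nth:
  "psi_vec a b c \<iota> v $ Z01 = \<iota> * inverse a * (v $ 1 * v $ 1 + v $ 2 * v $ 2)"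
  "psi_vec a b c \<iota> v $ Z02 = 2 * inverse b * (v $ 1 * v $ 2)"
  "psi_vec a b c \<iota> v $ Z03 = inverse c * (v $ 1 * v $ 1 - v $ 2 * v $ 2)"
  "psi_vec a b c \<iota> v $ Z12 = - c * (v $ 1 * v $ 1 - v $ 2 * v $ 2)"
  "psi_vec a b c \<iota> v $ Z13 = 2 * b * (v $ 1 * v $ 2)"
  "psi_vec a b c \<iota> v $ Z23 = - \<iota> * a * (v $ 1 * v $ 1 + v $ 2 * v $ 2)"
  by (simp_all add: psi_vec_def psi_formula_def power2_eq_square)

lemma psi_vec_scale: "psi_vec a b c \<iota> (r *s v) = r ^ 2 *s psi_vec a b c \<iota> v"
  by (simp add: zvec_eq_iff psi_vec_nth power2_eq_square algebra_simps)

text \<open>With \<open>X = \<iota> a z\<^sub>0\<^sub>1\<close>, \<open>Y = b z\<^sub>0\<^sub>2\<close>, \<open>W = c z\<^sub>0\<^sub>3\<close> the conic is \<open>X\<^sup>2 = Y\<^sup>2 + W\<^sup>2\<close>, parametrized by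
  \<open>X = -(s\<^sup>2 + t\<^sup>2)\<close>, \<open>Y = 2st\<close>, \<open>W = s\<^sup>2 - t\<^sup>2\<close>. The ratio \<open>s : t\<close> is \<open>W - X : Y\<close>, the formula for the
  inverse, and also \<open>Y : -(W + X)\<close>; the latter makes sense at the image of \<open>(0 : 1)\<close>.\<close>

definition second_chart :: "'k::field \<Rightarrow> 'k \<Rightarrow> 'k \<Rightarrow> 'k \<Rightarrow> 'k ^ zidx \<Rightarrow> 'k ^ 2" where
  "second_chart a b c \<iota> z = vector [b * z $ Z02, - (c * z $ Z03 + \<iota> * a * z $ Z01)]"

lemma psi_inv_formula_scale: "psi_inv_formula a b c \<iota> (r *s z) = r *s psi_inv_formula a b c \<iota> z"
  by (simp add: psi_inv_formula_def vec2_eq_iff algebra_simps)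

lemma second_chart_scale: "second_chart a b c \<iota> (r *s z) = r *s second_chart a b c \<iota> z"
  by (simp add: second_chart_def vec2_eq_iff algebra_simps)

context
  fixes a b c \<iota> :: "'k::field"
  assumes two: "(2 :: 'k) \<noteq> 0" and nz: "a \<noteq> 0" "b \<noteq> 0" "c \<noteq> 0" and i2: "\<iota> * \<iota> = -1"
begin

lemma psi_vec_diagonal_coords:
  "\<iota> * a * psi_vec a b c \<iota> v $ Z01 = - (v $ 1 * v $ 1 + v $ 2 * v $ 2)"
  "b * psi_vec a b c \<iota> v $ Z02 = 2 * (v $ 1 * v $ 2)"
  "c * psi_vec a b c \<iota> v $ Z03 = v $ 1 * v $ 1 - v $ 2 * v $ 2"
proof -
  have "\<iota> * a * (\<iota> * inverse a * x) = (\<iota> * \<iota>) * (a * inverse a) * x" for x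
    by (simp only: mult_ac)
  then show "\<iota> * a * psi_vec a b c \<iota> v $ Z01 = - (v $ 1 * v $ 1 + v $ 2 * v $ 2)"
    using nz i2 by (simp add: psi_vec_nth)
qed (use nz in \<open>simp_all add: psi_vec_nth\<close>)

lemma psi_inv_formula_psi_vec: "psi_inv_formula a b c \<iota> (psi_vec a b c \<iota> v) = (2 * v $ 1) *s v"
  by (simp add: psi_inv_formula_def vec2_eq_iff psi_vec_diagonal_coords)

lemma second_chart_psi_vec: "second_chart a b c \<iota> (psi_vec a b c \<iota> v) = (2 * v $ 2) *s v"
  by (simp add: second_chart_def vec2_eq_iff psi_vec_diagonal_coords)

lemma conic_diagonal_form:
  assumes "on_conic (a^2) (b^2) (c^2) z"
  shows "(\<iota> * a * z $ Z01) * (\<iota> * a * z $ Z01) =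
    (b * z $ Z02) * (b * z $ Z02) + (c * z $ Z03) * (c * z $ Z03)"
proof -
  have lin: "z $ Z23 = - (a^2) * z $ Z01" "z $ Z13 = b^2 * z $ Z02" "z $ Z12 = - (c^2) * z $ Z03"
    and quad: "z $ Z01 * z $ Z23 - z $ Z02 * z $ Z13 + z $ Z03 * z $ Z12 = 0"
    using assms unfolding on_conic_def by blast+
  have "z $ Z01 * (- (a^2) * z $ Z01) - z $ Z02 * (b^2 * z $ Z02) + z $ Z03 * (- (c^2) * z $ Z03) = 0"
    using quad unfolding lin .
  then have "- (a * a * (z $ Z01 * z $ Z01)) = b * b * (z $ Z02 * z $ Z02) + c * c * (z $ Z03 * z $ Z03)"
    by (simp add: power2_eq_square algebra_simps)
  moreover have "(\<iota> * a * z $ Z01) * (\<iota> * a * z $ Z01) = (\<iota> * \<iota>) * (a * a * (z $ Z01 * z $ Z01))"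
    by (simp only: mult_ac)
  ultimately show ?thesis by (simp add: i2 mult_ac)
qed

lemma psi_vec_on_conic: "on_conic (a^2) (b^2) (c^2) (psi_vec a b c \<iota> v)"
proof -
  let ?P = "v $ 1 * v $ 1 + v $ 2 * v $ 2" and ?M = "v $ 1 * v $ 1 - v $ 2 * v $ 2"
    and ?S = "v $ 1 * v $ 2"
  have square: "e^2 * inverse e = e" if "e \<noteq> 0" for e :: 'k
    using that by (simp add: power2_eq_square)
  have cancel: "(x * inverse e * u) * (y * e * u) = (x * y) * (u * u)" if "e \<noteq> 0" for e x y u :: 'k
  proof -
    have "(x * inverse e * u) * (y * e * u) = (inverse e * e) * ((x * y) * (u * u))"
      by (simp only: mult_ac)
    then show ?thesis using that by simp
  qed
  have "(\<iota> * inverse a * ?P) * (- \<iota> * a * ?P) - (2 * inverse b * ?S) * (2 * b * ?S) +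
      (1 * inverse c * ?M) * (- 1 * c * ?M) = ?P * ?P - 4 * (?S * ?S) - ?M * ?M"
    unfolding cancel[OF nz(1)] cancel[OF nz(2)] cancel[OF nz(3)] using i2 by simp
  also have "\<dots> = 0" by (simp add: algebra_simps)
  finally have "(\<iota> * inverse a * ?P) * (- \<iota> * a * ?P) - (2 * inverse b * ?S) * (2 * b * ?S) +
      (inverse c * ?M) * (- c * ?M) = 0"
    by (simp only: mult_1 mult_minus1)
  moreover have "- \<iota> * a * ?P = - (a^2) * (\<iota> * inverse a * ?P)" "2 * b * ?S = b^2 * (2 * inverse b * ?S)"
    "- c * ?M = - (c^2) * (inverse c * ?M)"
    using square[OF nz(1)] square[OF nz(2)] square[OF nz(3)] by simp_all
  ultimately show ?thesis unfolding on_conic_def psi_vec_nth by blast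
qed

text \<open>The linear equations express the remaining coordinates through \<open>z\<^sub>0\<^sub>1, z\<^sub>0\<^sub>2, z\<^sub>0\<^sub>3\<close>.\<close>

lemma conic_eqI:
  assumes z: "on_conic (a^2) (b^2) (c^2) z" and w: "on_conic (a^2) (b^2) (c^2) w"
    and "\<iota> * a * w $ Z01 = r * (\<iota> * a * z $ Z01)" "b * w $ Z02 = r * (b * z $ Z02)"
      "c * w $ Z03 = r * (c * z $ Z03)"
  shows "w = r *s z"
proof -
  have "\<iota> * a \<noteq> 0" using nz i2 by auto
  then have "w $ Z01 = r * z $ Z01" "w $ Z02 = r * z $ Z02" "w $ Z03 = r * z $ Z03"
    using assms(3-5) nz by (simp_all only: mult.left_commute[of r] mult_cancel_left) auto
  then show ?thesis using z w by (simp add: zvec_eq_iff on_conic_def)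
qed

text \<open>Substituting \<open>(s, t) = (W - X, Y)\<close> and \<open>(Y, -(W + X))\<close> into the parametrization multiplies
  \<open>(X, Y, W)\<close> by \<open>2(W - X)\<close> and \<open>-2(W + X)\<close> respectively, because \<open>X\<^sup>2 = Y\<^sup>2 + W\<^sup>2\<close>.\<close>

lemma psi_vec_psi_inv_formula:
  assumes z: "on_conic (a^2) (b^2) (c^2) z"
  shows "psi_vec a b c \<iota> (psi_inv_formula a b c \<iota> z) = (2 * (c * z $ Z03 - \<iota> * a * z $ Z01)) *s z"
proof (rule conic_eqI[OF z psi_vec_on_conic])
  have "- ((W - X) * (W - X) + Y * Y) = 2 * (W - X) * X" "(W - X) * (W - X) - Y * Y = 2 * (W - X) * W"
    if diag: "X * X = Y * Y + W * W" for X Y W :: 'k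
  proof -
    have "- ((W - X) * (W - X) + Y * Y) - 2 * (W - X) * X = X * X - (Y * Y + W * W)"
        "(W - X) * (W - X) - Y * Y - 2 * (W - X) * W = X * X - (Y * Y + W * W)"
      by (simp_all add: algebra_simps)
    then show "- ((W - X) * (W - X) + Y * Y) = 2 * (W - X) * X" "(W - X) * (W - X) - Y * Y = 2 * (W - X) * W"
      using diag by simp_all
  qed
  note this[OF conic_diagonal_form[OF z]]
  then show "\<iota> * a * psi_vec a b c \<iota> (psi_inv_formula a b c \<iota> z) $ Z01 =
      2 * (c * z $ Z03 - \<iota> * a * z $ Z01) * (\<iota> * a * z $ Z01)"
    "c * psi_vec a b c \<iota> (psi_inv_formula a b c \<iota> z) $ Z03 =
      2 * (c * z $ Z03 - \<iota> * a * z $ Z01) * (c * z $ Z03)"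
    by (simp_all only: psi_vec_diagonal_coords psi_inv_formula_def vector_2)
qed (simp add: psi_vec_diagonal_coords psi_inv_formula_def)

lemma psi_vec_second_chart:
  assumes z: "on_conic (a^2) (b^2) (c^2) z"
  shows "psi_vec a b c \<iota> (second_chart a b c \<iota> z) = (- 2 * (c * z $ Z03 + \<iota> * a * z $ Z01)) *s z"
proof (rule conic_eqI[OF z psi_vec_on_conic])
  have "- (Y * Y + - (W + X) * - (W + X)) = - 2 * (W + X) * X"
    "Y * Y - - (W + X) * - (W + X) = - 2 * (W + X) * W"
    if diag: "X * X = Y * Y + W * W" for X Y W :: 'k
  proof -
    have "- (Y * Y + - (W + X) * - (W + X)) - - 2 * (W + X) * X = X * X - (Y * Y + W * W)"
        "Y * Y - - (W + X) * - (W + X) - - 2 * (W + X) * W = (Y * Y + W * W) - X * X"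
      by (simp_all add: algebra_simps)
    then show "- (Y * Y + - (W + X) * - (W + X)) = - 2 * (W + X) * X"
        "Y * Y - - (W + X) * - (W + X) = - 2 * (W + X) * W"
      using diag by simp_all
  qed
  note this[OF conic_diagonal_form[OF z]]
  then show "\<iota> * a * psi_vec a b c \<iota> (second_chart a b c \<iota> z) $ Z01 =
      - 2 * (c * z $ Z03 + \<iota> * a * z $ Z01) * (\<iota> * a * z $ Z01)"
    "c * psi_vec a b c \<iota> (second_chart a b c \<iota> z) $ Z03 =
      - 2 * (c * z $ Z03 + \<iota> * a * z $ Z01) * (c * z $ Z03)"
    by (simp_all only: psi_vec_diagonal_coords second_chart_def vector_2)
qed (simp add: psi_vec_diagonal_coords second_chart_def)

lemma psi_vec_nonzero: "v \<noteq> 0 \<Longrightarrow> psi_vec a b c \<iota> v \<noteq> 0"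
  using psi_inv_formula_psi_vec[of v] second_chart_psi_vec[of v] two
  by (auto simp: psi_inv_formula_def second_chart_def vec2_eq_iff)

text \<open>The two charts cover the conic: \<open>W = X\<close> and \<open>W = -X\<close> together give \<open>X = W = 0\<close>, hence \<open>Y = 0\<close>.\<close>

lemma charts_cover:
  assumes z: "on_conic (a^2) (b^2) (c^2) z" "z \<noteq> 0"
  shows "c * z $ Z03 - \<iota> * a * z $ Z01 \<noteq> 0 \<or> c * z $ Z03 + \<iota> * a * z $ Z01 \<noteq> 0"
proof (rule ccontr)
  assume "\<not> ?thesis"
  then have eq: "c * z $ Z03 = \<iota> * a * z $ Z01" "c * z $ Z03 = - (\<iota> * a * z $ Z01)"
    by (simp_all add: eq_neg_iff_add_eq_0)
  have "2 * (c * z $ Z03) = \<iota> * a * z $ Z01 + - (\<iota> * a * z $ Z01)"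
    unfolding mult_2 by (metis eq)
  then have "z $ Z03 = 0" using two nz by simp
  moreover have "z $ Z01 = 0" using calculation eq(1) nz i2 by auto
  ultimately have "z $ Z02 = 0" using conic_diagonal_form[OF z(1)] nz by simp
  with \<open>z $ Z03 = 0\<close> \<open>z $ Z01 = 0\<close> show False
    using z by (simp add: on_conic_def zvec_eq_iff)
qed

definition psi_map :: "('k ^ 2) set \<Rightarrow> ('k ^ zidx) set" where
  "psi_map = proj_map (psi_vec a b c \<iota>)"

lemma psi_map_pt: "psi_map (pt v) = pt (psi_vec a b c \<iota> v)"
  unfolding psi_map_def by (rule proj_map_pt) (rule psi_vec_scale)

lemma psi_map_first_chart:
  assumes z: "on_conic (a^2) (b^2) (c^2) z" "c * z $ Z03 - \<iota> * a * z $ Z01 \<noteq> 0"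
  shows "psi_inv_formula a b c \<iota> z \<noteq> 0" "psi_map (pt (psi_inv_formula a b c \<iota> z)) = pt z"
proof -
  have "2 * (c * z $ Z03 - \<iota> * a * z $ Z01) \<noteq> 0" using two z(2) by simp
  then show "psi_map (pt (psi_inv_formula a b c \<iota> z)) = pt z"
    unfolding psi_map_pt psi_vec_psi_inv_formula[OF z(1)] by (rule pt_scale)
  show "psi_inv_formula a b c \<iota> z \<noteq> 0"
    using z(2) by (simp add: psi_inv_formula_def vec2_eq_iff[of _ 0])
qed

lemma psi_map_second_chart:
  assumes z: "on_conic (a^2) (b^2) (c^2) z" "c * z $ Z03 + \<iota> * a * z $ Z01 \<noteq> 0"
  shows "second_chart a b c \<iota> z \<noteq> 0" "psi_map (pt (second_chart a b c \<iota> z)) = pt z"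
proof -
  have "- 2 * (c * z $ Z03 + \<iota> * a * z $ Z01) \<noteq> 0"
    using two z(2) by (metis mult_eq_0_iff neg_equal_0_iff_equal)
  then show "psi_map (pt (second_chart a b c \<iota> z)) = pt z"
    unfolding psi_map_pt psi_vec_second_chart[OF z(1)] by (rule pt_scale)
  show "second_chart a b c \<iota> z \<noteq> 0"
  proof
    assume "second_chart a b c \<iota> z = 0"
    then have "second_chart a b c \<iota> z $ 2 = 0" by simp
    then show False using z(2) by (simp add: second_chart_def add_eq_0_iff)
  qed
qed

text \<open>Composing the parametrization with the two charts multiplies \<open>v = (s, t)\<close> by \<open>2s\<close> and by \<open>2t\<close>. For
  every point at least one of these factors is nonzero, which recovers the point from its image.\<close>

lemma bij_betw_psi_map: "bij_betw psi_map proj_space (conic_C0 (a^2) (b^2) (c^2))"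
  unfolding bij_betw_def
proof
  show "inj_on psi_map proj_space"
  proof (rule inj_onI)
    fix P Q :: "('k ^ 2) set"
    assume "P \<in> proj_space" "Q \<in> proj_space" and eq: "psi_map P = psi_map Q"
    then obtain v w where P: "P = pt v" "v \<noteq> 0" and Q: "Q = pt w" "w \<noteq> 0"
      by (auto simp: proj_space_def)
    have "pt (psi_vec a b c \<iota> v) = pt (psi_vec a b c \<iota> w)"
      using eq by (simp add: P Q psi_map_pt)
    then obtain r where r: "r \<noteq> 0" "psi_vec a b c \<iota> v = r *s psi_vec a b c \<iota> w" by (rule pt_eqE)
    have first: "(2 * v $ 1) *s v = (r * (2 * w $ 1)) *s w"
      using arg_cong[OF r(2), of "psi_inv_formula a b c \<iota>"]
      by (simp add: psi_inv_formula_scale psi_inv_formula_psi_vec)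
    have second: "(2 * v $ 2) *s v = (r * (2 * w $ 2)) *s w"
      using arg_cong[OF r(2), of "second_chart a b c \<iota>"]
      by (simp add: second_chart_scale second_chart_psi_vec)
    have same: "pt v = pt w" if "p \<noteq> 0" "p *s v = q *s w" for p q
    proof -
      have "q \<noteq> 0" using that P(2) by auto
      then show ?thesis using that by (metis pt_scale)
    qed
    \<comment> \<open>use the chart whose factor is nonzero at \<open>v\<close>\<close>
    show "P = Q"
    proof (cases "v $ 1 = 0")
      case True
      then have "v $ 2 \<noteq> 0" using P(2) by (simp add: vec2_eq_iff)
      then show ?thesis using same[OF _ second] two by (simp add: P Q)
    next
      case False
      then show ?thesis using same[OF _ first] two by (simp add: P Q)
    qed
  qed
  show "psi_map ` proj_space = conic_C0 (a^2) (b^2) (c^2)"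
  proof (intro equalityI subsetI)
    fix Q assume "Q \<in> psi_map ` proj_space"
    then show "Q \<in> conic_C0 (a^2) (b^2) (c^2)"
      by (auto simp: proj_space_def psi_map_pt pt_in_conic_iff psi_vec_nonzero psi_vec_on_conic)
  next
    fix Q assume Q: "Q \<in> conic_C0 (a^2) (b^2) (c^2)"
    then obtain z where z: "Q = pt z" by (auto simp: conic_C0_def proj_zeros_def)
    then have "on_conic (a^2) (b^2) (c^2) z" "z \<noteq> 0" using Q by (simp_all add: pt_in_conic_iff)
    then show "Q \<in> psi_map ` proj_space"
      using charts_cover psi_map_first_chart[of z] psi_map_second_chart[of z] unfolding z
      by (metis imageI pt_in_proj_space_iff)
  qed
qed

lemma inv_psi_map: "v \<noteq> 0 \<Longrightarrow> psi_map (pt v) = Q \<Longrightarrow> inv_into proj_space psi_map Q = pt v"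
  by (rule inv_into_f_eq[OF bij_betw_imp_inj_on[OF bij_betw_psi_map]]) simp_all

lemma is_morphism_psi_map: "is_morphism proj_space (conic_C0 (a^2) (b^2) (c^2)) psi_map"
proof (rule is_morphism_by_charts)
  fix v :: "'k ^ 2" assume "pt v \<in> proj_space"
  then show "psi_map (pt v) \<in> conic_C0 (a^2) (b^2) (c^2)"
    using bij_betw_psi_map by (auto simp: bij_betw_def)
  let ?s = "mpoly_var 1 :: (2, 'k) mpoly" and ?t = "mpoly_var 2 :: (2, 'k) mpoly"
  define F where "F j = (case j of
      Z01 \<Rightarrow> mpoly_const (\<iota> * inverse a) * (?s * ?s + ?t * ?t)
    | Z02 \<Rightarrow> mpoly_const (2 * inverse b) * (?s * ?t)
    | Z03 \<Rightarrow> mpoly_const (inverse c) * (?s * ?s - ?t * ?t)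
    | Z12 \<Rightarrow> mpoly_const (- c) * (?s * ?s - ?t * ?t)
    | Z13 \<Rightarrow> mpoly_const (2 * b) * (?s * ?t)
    | Z23 \<Rightarrow> mpoly_const (- \<iota> * a) * (?s * ?s + ?t * ?t))" for j
  have F: "(\<chi> j. mpoly_eval (F j) w) = psi_vec a b c \<iota> w" for w
    by (simp add: zvec_eq_iff psi_vec_nth F_def)
  have "homogeneous 2 (F j)" for j
    by (cases j) (simp_all add: F_def)
  then show "\<exists>h e d F. homogeneous e h \<and> mpoly_eval h v \<noteq> 0 \<and> (\<forall>j. homogeneous d (F j)) \<and>
      (\<forall>w. pt w \<in> proj_space \<and> mpoly_eval h w \<noteq> 0 \<longrightarrow>
        (\<chi> j. mpoly_eval (F j) w) \<noteq> 0 \<and> psi_map (pt w) = pt (\<chi> j. mpoly_eval (F j) w))"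
    by (intro exI[of _ "mpoly_const 1"] exI[of _ 0] exI[of _ 2] exI[of _ F])
       (simp add: F psi_map_pt psi_vec_nonzero)
qed simp

lemma is_morphism_inv_psi_map:
  "is_morphism (conic_C0 (a^2) (b^2) (c^2)) proj_space (inv_into proj_space psi_map)"
proof (rule is_morphism_by_charts)
  show "conic_C0 (a^2) (b^2) (c^2) \<subseteq> proj_space"
    unfolding conic_C0_def by (rule proj_zeros_subset)
  fix z assume z: "pt z \<in> conic_C0 (a^2) (b^2) (c^2)"
  then show "inv_into proj_space psi_map (pt z) \<in> proj_space"
    using bij_betw_psi_map by (metis bij_betw_def inv_into_into)
  define p where "p = mpoly_const c * mpoly_var Z03 - mpoly_const (\<iota> * a) * mpoly_var Z01"
  define q where "q = mpoly_const c * mpoly_var Z03 + mpoly_const (\<iota> * a) * mpoly_var Z01"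
  define F where "F j = (if j = 1 then p else mpoly_const b * mpoly_var Z02)" for j :: 2
  define G where "G j = (if j = 1 then mpoly_const b * mpoly_var Z02 else - q)" for j :: 2
  have hom: "homogeneous 1 p" "homogeneous 1 q" "homogeneous 1 (F j)" "homogeneous 1 (G j)" for j
    by (simp_all add: p_def q_def F_def G_def)
  have F: "(\<chi> j. mpoly_eval (F j) w) = psi_inv_formula a b c \<iota> w" for w
    by (simp add: F_def p_def psi_inv_formula_def vec2_eq_iff)
  have G: "(\<chi> j. mpoly_eval (G j) w) = second_chart a b c \<iota> w" for w
    by (simp add: G_def q_def second_chart_def vec2_eq_iff)
  let ?chart = "\<lambda>h F. homogeneous 1 h \<and> mpoly_eval h z \<noteq> 0 \<and> (\<forall>j. homogeneous 1 (F j)) \<and>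
      (\<forall>w. pt w \<in> conic_C0 (a^2) (b^2) (c^2) \<and> mpoly_eval h w \<noteq> 0 \<longrightarrow>
        (\<chi> j. mpoly_eval (F j) w) \<noteq> 0 \<and>
        inv_into proj_space psi_map (pt w) = pt (\<chi> j. mpoly_eval (F j) w))"
  have p: "mpoly_eval p w = c * w $ Z03 - \<iota> * a * w $ Z01"
    and q: "mpoly_eval q w = c * w $ Z03 + \<iota> * a * w $ Z01" for w
    by (simp_all add: p_def q_def)
  have "?chart p F" if "mpoly_eval p z \<noteq> 0"
    using that hom psi_map_first_chart inv_psi_map unfolding F p by (auto simp: pt_in_conic_iff)
  moreover have "?chart q G" if "mpoly_eval q z \<noteq> 0"
    using that hom psi_map_second_chart inv_psi_map unfolding G q by (auto simp: pt_in_conic_iff)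
  moreover have "mpoly_eval p z \<noteq> 0 \<or> mpoly_eval q z \<noteq> 0"
    unfolding p q by (rule charts_cover) (use z in \<open>simp_all add: pt_in_conic_iff\<close>)
  ultimately show "\<exists>h e d F. homogeneous e h \<and> mpoly_eval h z \<noteq> 0 \<and> (\<forall>j. homogeneous d (F j)) \<and>
      (\<forall>w. pt w \<in> conic_C0 (a^2) (b^2) (c^2) \<and> mpoly_eval h w \<noteq> 0 \<longrightarrow>
        (\<chi> j. mpoly_eval (F j) w) \<noteq> 0 \<and>
        inv_into proj_space psi_map (pt w) = pt (\<chi> j. mpoly_eval (F j) w))"
    by blast
qed

lemma is_isomorphism_psi_map: "is_isomorphism proj_space (conic_C0 (a^2) (b^2) (c^2)) psi_map"
  by (simp add: is_isomorphism_def bij_betw_psi_map is_morphism_psi_map is_morphism_inv_psi_map)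

lemma inv_psi_map_formula:
  assumes z: "pt z \<in> conic_C0 (a^2) (b^2) (c^2)" and ne: "pt z \<noteq> psi_map (pt (vector [0, 1]))"
  shows "inv_into proj_space psi_map (pt z) = pt (psi_inv_formula a b c \<iota> z)"
proof -
  obtain v where v: "v \<noteq> 0" "pt z = psi_map (pt v)"
    using z bij_betw_psi_map by (auto simp: bij_betw_def proj_space_def elim!: equalityE)
  have "v $ 1 \<noteq> 0"
  proof
    assume "v $ 1 = 0"
    then have "v = v $ 2 *s vector [0, 1]" by (simp add: vec2_eq_iff)
    moreover have "v $ 2 \<noteq> 0" using v(1) \<open>v $ 1 = 0\<close> by (simp add: vec2_eq_iff)
    ultimately have "pt v = pt (vector [0, 1])" by (metis pt_scale)
    then show False using ne v(2) by simp
  qed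
  obtain r where r: "r \<noteq> 0" "z = r *s psi_vec a b c \<iota> v"
    using v(2) unfolding psi_map_pt by (rule pt_eqE)
  have "psi_inv_formula a b c \<iota> z = (r * (2 * v $ 1)) *s v"
    by (simp add: r(2) psi_inv_formula_scale psi_inv_formula_psi_vec)
  then have "pt (psi_inv_formula a b c \<iota> z) = pt v"
    using r(1) two \<open>v $ 1 \<noteq> 0\<close> by simp
  then show ?thesis using inv_psi_map[OF v(1)] v(2) by simp
qed

end

theorem proposition5p2:
  fixes \<alpha> \<beta> \<gamma> a b c \<iota> :: "'k::alg_closed_field"
  assumes "CHAR('k) \<noteq> 2" and "CHAR('k) \<noteq> 3"
    and "\<alpha> \<notin> {0, 1, -1}" and "\<beta> \<notin> {0, 1, -1}" and "\<gamma> \<notin> {0, 1, -1}"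
    and "\<alpha> + \<beta> + \<gamma> + \<alpha> * \<beta> * \<gamma> = 0"
    and "a^2 = \<alpha>" and "b^2 = \<beta>" and "c^2 = \<gamma>" and "\<iota>^2 = -1"
  shows
    "defines_smooth_conic (C0_quadric :: (zidx, 'k) mpoly) (C0_linear \<alpha> \<beta> \<gamma>) \<and>
     (\<forall>l l'. vec.dim {l, l'} = 2 \<longrightarrow>
        (commuting_line \<alpha> \<beta> \<gamma> (proj_line l l') \<longleftrightarrow> pt (pluecker l l') \<in> conic_C0 \<alpha> \<beta> \<gamma>)) \<and>
     (\<exists>\<psi> :: ('k ^ 2) set \<Rightarrow> ('k ^ zidx) set.
        is_isomorphism proj_space (conic_C0 \<alpha> \<beta> \<gamma>) \<psi> \<and>
        (\<forall>s t. (s, t) \<noteq> (0, 0) \<longrightarrow> \<psi> (pt (vector [s, t])) = pt (psi_formula a b c \<iota> s t)) \<and>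
        (\<forall>z. pt z \<in> conic_C0 \<alpha> \<beta> \<gamma> \<and> pt z \<noteq> \<psi> (pt (vector [0, 1])) \<longrightarrow>
           inv_into proj_space \<psi> (pt z) = pt (psi_inv_formula a b c \<iota> z)))"
proof (intro conjI allI impI exI[of _ "psi_map a b c \<iota>"])
  have two: "(2 :: 'k) \<noteq> 0"
  proof
    assume "(2 :: 'k) = 0"
    then have "CHAR('k) dvd 2"
      using of_nat_eq_0_iff_char_dvd[of 2, where 'a = 'k] by simp
    then have "CHAR('k) = 1 \<or> CHAR('k) = 2"
      using prime_nat_iff two_is_prime_nat by blast
    then show False using assms(1) by simp
  qed
  have nz: "a \<noteq> 0" "b \<noteq> 0" "c \<noteq> 0" and i2: "\<iota> * \<iota> = -1"
    using assms by (auto simp: power2_eq_square)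
  note param = two nz i2
  have squares: "\<alpha> = a^2" "\<beta> = b^2" "\<gamma> = c^2" using assms by simp_all
  show "defines_smooth_conic (C0_quadric :: (zidx, 'k) mpoly) (C0_linear \<alpha> \<beta> \<gamma>)"
    using assms by (intro C0_smooth_conic two) auto
  show "commuting_line \<alpha> \<beta> \<gamma> (proj_line l l') \<longleftrightarrow> pt (pluecker l l') \<in> conic_C0 \<alpha> \<beta> \<gamma>"
    if "vec.dim {l, l'} = 2" for l l'
    using two that by (rule commuting_line_iff_pluecker_on_conic)
  show "is_isomorphism proj_space (conic_C0 \<alpha> \<beta> \<gamma>) (psi_map a b c \<iota>)"
    unfolding squares by (rule is_isomorphism_psi_map[OF param])
  show "psi_map a b c \<iota> (pt (vector [s, t])) = pt (psi_formula a b c \<iota> s t)" for s t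
    by (simp add: psi_map_pt[OF param] psi_vec_def)
  show "inv_into proj_space (psi_map a b c \<iota>) (pt z) = pt (psi_inv_formula a b c \<iota> z)"
    if "pt z \<in> conic_C0 \<alpha> \<beta> \<gamma> \<and> pt z \<noteq> psi_map a b c \<iota> (pt (vector [0, 1]))" for z
    by (rule inv_psi_map_formula[OF param]) (use that in \<open>simp_all add: squares\<close>)
qed

end
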